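(* For every integer $r$ with $2\leq r\leq 6$, every graph $G$ that has no $K_r$ minor is generically $(r-2)$-stress free.
   Context: All graphs are finite and simple (no loops, no multiple edges). $K_r$ is the complete graph on $r$ vertices. Contracting an edge $\{v,u\}$ means identifying $v$ and $u$, deleting the resulting loop and one copy of each double edge created, to obtain a new simple graph. A graph $H$ is a minor of $G$ if $H$ can be obtained, up to isomorphism, from a subgraph of $G$ by repeated contraction of edges; $G$ has an $H$ minor if $H$ is a minor of $G$. Let $G=(V,E)$ be a graph and $d\ge 0$ an integer. A $d$-embedding of $G$ is any map $f:V\to\mathbb{R}^d$ (no injectivity is required). A stress with respect to $f$ is a function $w:E\to\mathbb{R}$ such that for every vertex $v\in V$ $$\sum_{u:\{v,u\}\in E} w(\{v,u\})\,(f(v)-f(u))=0 .$$ $G$ is called generically $d$-stress free if the set of $d$-embeddings $f$ for which the only stress is $w=0$ is open and dense in the space $(\mathbb{R}^d)^V$ of all $d$-embeddings. *)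

theory Defs
  imports "HOL-Analysis.Analysis"
begin

text \<open>A graph is a pair of a vertex set and a set of edges, each edge being a two-element set.\<close>

type_synonym 'a sgraph = "'a set \<times> 'a set set"

abbreviation verts :: "'a sgraph \<Rightarrow> 'a set" where
  "verts G \<equiv> fst G"

abbreviation edges :: "'a sgraph \<Rightarrow> 'a set set" where
  "edges G \<equiv> snd G"

definition simple_graph :: "'a sgraph \<Rightarrow> bool" where
  "simple_graph G \<longleftrightarrow>
     finite (verts G) \<and> edges G \<subseteq> {{u, v} | u v. u \<in> verts G \<and> v \<in> verts G \<and> u \<noteq> v}"

definition complete_graph :: "nat \<Rightarrow> nat sgraph" where
  "complete_graph r = ({..<r}, {{i, j} | i j. i < r \<and> j < r \<and> i \<noteq> j})"

definition subgraph :: "'a sgraph \<Rightarrow> 'a sgraph \<Rightarrow> bool" where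
  "subgraph H G \<longleftrightarrow> simple_graph H \<and> verts H \<subseteq> verts G \<and> edges H \<subseteq> edges G"

definition graph_iso :: "'a sgraph \<Rightarrow> 'b sgraph \<Rightarrow> bool" where
  "graph_iso G H \<longleftrightarrow>
     (\<exists>\<phi>. bij_betw \<phi> (verts G) (verts H) \<and> edges H = (\<lambda>e. \<phi> ` e) ` edges G)"

text \<open>The vertex \<open>u\<close> is identified with \<open>v\<close>. The edge \<open>{v, u}\<close> is mapped to the
  loop \<open>{v}\<close>, which is deleted; parallel edges coincide because edges form a set.\<close>

definition contract :: "'a \<Rightarrow> 'a \<Rightarrow> 'a sgraph \<Rightarrow> 'a sgraph" where
  "contract v u G =
     (id(u := v) ` verts G, (\<lambda>e. id(u := v) ` e) ` edges G - {{v}})"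

definition contraction_step :: "'a sgraph \<Rightarrow> 'a sgraph \<Rightarrow> bool" where
  "contraction_step G G' \<longleftrightarrow> (\<exists>v u. {v, u} \<in> edges G \<and> G' = contract v u G)"

definition is_minor :: "'b sgraph \<Rightarrow> 'a sgraph \<Rightarrow> bool" where
  "is_minor H G \<longleftrightarrow>
     (\<exists>S T. subgraph S G \<and> contraction_step\<^sup>*\<^sup>* S T \<and> graph_iso T H)"

text \<open>\<open>\<real>\<^sup>d\<close> is the library's \<^const>\<open>Euclidean_space\<close>, whose points are the
  sequences vanishing at all indices \<open>i \<ge> d\<close>; this covers \<open>d = 0\<close> as well. The points of the
  product topology below are exactly the maps from the vertex set to \<open>\<real>\<^sup>d\<close> (extended
  by \<^const>\<open>undefined\<close> outside the vertex set).\<close>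

definition embedding_space :: "nat \<Rightarrow> 'a sgraph \<Rightarrow> ('a \<Rightarrow> nat \<Rightarrow> real) topology" where
  "embedding_space d G = product_topology (\<lambda>_. Euclidean_space d) (verts G)"

text \<open>The vector equation is written coordinatewise. Values of \<open>w\<close> outside the edge set are
  irrelevant, hence the form of the conclusion in \<open>stress_free\<close>.\<close>

definition is_stress :: "nat \<Rightarrow> 'a sgraph \<Rightarrow> ('a \<Rightarrow> nat \<Rightarrow> real) \<Rightarrow> ('a set \<Rightarrow> real) \<Rightarrow> bool" where
  "is_stress d G f w \<longleftrightarrow>
     (\<forall>v\<in>verts G. \<forall>i<d. (\<Sum>u | {v, u} \<in> edges G. w {v, u} * (f v i - f u i)) = 0)"

definition stress_free :: "nat \<Rightarrow> 'a sgraph \<Rightarrow> ('a \<Rightarrow> nat \<Rightarrow> real) \<Rightarrow> bool" where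
  "stress_free d G f \<longleftrightarrow> (\<forall>w. is_stress d G f w \<longrightarrow> (\<forall>e\<in>edges G. w e = 0))"

definition generically_stress_free :: "nat \<Rightarrow> 'a sgraph \<Rightarrow> bool" where
  "generically_stress_free d G \<longleftrightarrow>
     (let X = embedding_space d G; S = {f \<in> topspace X. stress_free d G f}
      in openin X S \<and> X closure_of S = topspace X)"

end

theory Submission
  imports Defs "HOL-Computational_Algebra.Polynomial"
begin

text \<open>Write \<open>d = r - 2\<close>. Stress-freeness says that the columns of the rigidity
  matrix are independent. By Gaussian elimination this persists off finitely many points
  of every line through a single stress-free embedding, so that one such embedding is enough.
  It is found by induction on the number of edges.

  If some edge lies in fewer than \<open>d\<close> triangles, contract it and split the vertex again
  (Whiteley): moving one end infinitesimally in a generic direction keeps the columns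
  independent. Otherwise every edge lies in at least \<open>d\<close> triangles. By induction all proper
  subgraphs are stress free, and comparing ranks, a subgraph on \<open>n\<close> vertices has at
  most \<open>d (n - 1)\<close> edges (at most one more for the whole graph). Hence
  there is a vertex \<open>v\<close> of degree less than \<open>2 d\<close>, and its link, which has minimum
  degree at least \<open>d\<close>, contains a \<open>K\<^bsub>r-1\<^esub>\<close> minor if \<open>r\<close> is 4 or 5
  (for \<open>r \<le> 3\<close> an edge or a triangle suffices).

  For \<open>r = 6\<close> the link has at most seven vertices and may be planar (an octahedron or a
  pentagonal bipyramid). Unless it has a \<open>K\<^sub>5\<close> minor, though, each of its edges lies in at most two triangles of the link and
  every additional edge creates a \<open>K\<^sub>5\<close> minor. So the components outside the closed star
  of \<open>v\<close> attach to cliques with at most three vertices. Choosing \<open>v\<close> inside a minimal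
  set whose boundary is such a clique, all of them attach to one common clique, and an edge of the
  link outside it lies in at most three triangles.\<close>

section \<open>Generic independence of columns\<close>

definition indep_columns :: "'r set \<Rightarrow> 'e set \<Rightarrow> ('r \<Rightarrow> 'e \<Rightarrow> real) \<Rightarrow> bool" where
  "indep_columns R E a \<longleftrightarrow>
     (\<forall>w. (\<forall>r\<in>R. (\<Sum>e\<in>E. w e * a r e) = 0) \<longrightarrow> (\<forall>e\<in>E. w e = 0))"

lemma indep_columns_cong:
  assumes "\<And>r e. r \<in> R \<Longrightarrow> e \<in> E \<Longrightarrow> a r e = b r e"
  shows "indep_columns R E a \<longleftrightarrow> indep_columns R E b"
  unfolding indep_columns_def using assms by (simp cong: sum.cong ball_cong)

lemma indep_columns_pivot:
  assumes "indep_columns R E a" "finite E" "e \<in> E"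
  obtains r where "r \<in> R" "a r e \<noteq> 0"
proof -
  have "\<exists>r\<in>R. a r e \<noteq> 0"
  proof (rule ccontr)
    assume "\<not> ?thesis"
    then have "(\<Sum>e'\<in>E. (if e' = e then 1 else 0) * a r e') = 0" if "r \<in> R" for r
      using that by (intro sum.neutral) auto
    then have "\<forall>e'\<in>E. (if e' = e then 1 else 0) = (0::real)"
      using assms(1)[unfolded indep_columns_def, rule_format, of "\<lambda>e'. if e' = e then 1 else 0"]
      by blast
    then show False using assms(3) by auto
  qed
  then show thesis using that by blast
qed

text \<open>Gaussian elimination without division: the new entries are 2 by 2 minors, so for entries
  that depend on a parameter they stay in any class of functions closed under products and
  differences. The pivot row becomes zero and may remain in \<open>R\<close>.\<close>

lemma indep_columns_eliminate:
  assumes fin: "finite E" and e: "e \<notin> E" and r0: "r0 \<in> R" and pivot: "a r0 e \<noteq> 0"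
  shows "indep_columns R (insert e E) a \<longleftrightarrow>
         indep_columns R E (\<lambda>r e'. a r0 e * a r e' - a r e * a r0 e')"
    (is "?L \<longleftrightarrow> indep_columns R E ?b")
proof
  have b: "(\<Sum>e'\<in>E. w e' * ?b r e') =
      a r0 e * (\<Sum>e'\<in>E. w e' * a r e') - a r e * (\<Sum>e'\<in>E. w e' * a r0 e')" for w r
    by (simp add: sum_distrib_left sum_subtractf algebra_simps)
  { assume L: ?L
    show "indep_columns R E ?b"
      unfolding indep_columns_def
    proof (intro allI impI)
      fix w assume w: "\<forall>r\<in>R. (\<Sum>e'\<in>E. w e' * ?b r e') = 0"
      \<comment> \<open>The weight of \<open>e\<close> is obtained by solving the equation of the
        pivot row.\<close>
      define W where "W = w(e := - (\<Sum>e'\<in>E. w e' * a r0 e') / a r0 e)"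
      have WE: "(\<Sum>e'\<in>E. W e' * a r e') = (\<Sum>e'\<in>E. w e' * a r e')" for r
        by (rule sum.cong) (use e in \<open>auto simp: W_def\<close>)
      have "(\<Sum>e'\<in>insert e E. W e' * a r e') = 0" if "r \<in> R" for r
      proof -
        have "a r0 e * (\<Sum>e'\<in>insert e E. W e' * a r e') =
            a r0 e * (\<Sum>e'\<in>E. w e' * a r e') + (a r0 e * W e) * a r e"
          using fin e by (simp add: WE distrib_left)
        also have "a r0 e * W e = - (\<Sum>e'\<in>E. w e' * a r0 e')"
          using pivot by (simp add: W_def)
        also have "a r0 e * (\<Sum>e'\<in>E. w e' * a r e') + \<dots> * a r e = 0"
          using w[rule_format, OF that] unfolding b by (simp add: mult.commute)
        finally have "a r0 e * (\<Sum>e'\<in>insert e E. W e' * a r e') = 0" .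
        then show ?thesis using pivot by simp
      qed
      then have "\<forall>e'\<in>insert e E. W e' = 0"
        using L unfolding indep_columns_def by blast
      then show "\<forall>e'\<in>E. w e' = 0" using e by (auto simp: W_def split: if_splits)
    qed }
  { assume I: "indep_columns R E ?b"
    show ?L
      unfolding indep_columns_def
    proof (intro allI impI)
      fix w assume w: "\<forall>r\<in>R. (\<Sum>e'\<in>insert e E. w e' * a r e') = 0"
      have w': "(\<Sum>e'\<in>E. w e' * a r e') = - w e * a r e" if "r \<in> R" for r
      using w[rule_format, OF that] fin e by (simp add: eq_neg_iff_add_eq_0)
      then have "\<forall>r\<in>R. (\<Sum>e'\<in>E. w e' * ?b r e') = 0"
        using r0 unfolding b by simp
      then have 0: "\<forall>e'\<in>E. w e' = 0" using I unfolding indep_columns_def by blast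
      then have "w e * a r0 e = 0" using w'[OF r0] by simp
      then show "\<forall>e'\<in>insert e E. w e' = 0" using 0 pivot by simp
    qed }
qed

lemma card_le_if_indep_columns:
  assumes "finite E" "finite R" "indep_columns R E a"
  shows "card E \<le> card R"
  using assms
proof (induction E arbitrary: R a rule: finite_induct)
  case (insert e E)
  obtain r0 where r0: "r0 \<in> R" "a r0 e \<noteq> 0"
    using indep_columns_pivot[OF insert.prems(2), of e] insert.hyps by auto
  let ?b = "\<lambda>r e'. a r0 e * a r e' - a r e * a r0 e'"
  have "indep_columns R E ?b"
    using insert.prems(2) indep_columns_eliminate[OF insert.hyps r0(1), of a] r0(2) by blast
  then have "indep_columns (R - {r0}) E ?b"
    unfolding indep_columns_def
  proof (rule all_forward, intro impI)
    fix w
    assume *: "(\<forall>r\<in>R. (\<Sum>e'\<in>E. w e' * ?b r e') = 0) \<longrightarrow> (\<forall>e'\<in>E. w e' = 0)"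
      and w: "\<forall>r\<in>R - {r0}. (\<Sum>e'\<in>E. w e' * ?b r e') = 0"
    have "(\<Sum>e'\<in>E. w e' * ?b r e') = 0" if "r \<in> R" for r
      using that w by (cases "r = r0") auto
    then show "\<forall>e'\<in>E. w e' = 0" using * by blast
  qed
  then have "card E \<le> card (R - {r0})" using insert.IH insert.prems(1) by blast
  then show ?case using r0 insert.hyps insert.prems(1)
    by (simp add: card_Diff_singleton_if split: if_splits) (metis Suc_pred card_gt_0_iff emptyE not_less_eq_eq)
qed simp

text \<open>\<open>A\<close> stands for a class of functions such as polynomials or continuous
  functions. Elimination at \<open>x0\<close> meets finitely many pivots, all in \<open>A\<close>
  and nonzero at \<open>x0\<close>; by \<open>nz\<close> they are eventually nonzero along
  \<open>F\<close>, where the same elimination then works.\<close>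

lemma eventually_indep_columns:
  fixes a :: "'r \<Rightarrow> 'e \<Rightarrow> 'x \<Rightarrow> real"
  assumes mult: "\<And>p q. p \<in> A \<Longrightarrow> q \<in> A \<Longrightarrow> (\<lambda>x. p x * q x) \<in> A"
    and diff: "\<And>p q. p \<in> A \<Longrightarrow> q \<in> A \<Longrightarrow> (\<lambda>x. p x - q x) \<in> A"
    and nz: "\<And>p. p \<in> A \<Longrightarrow> p x0 \<noteq> 0 \<Longrightarrow> eventually (\<lambda>x. p x \<noteq> 0) F"
    and "finite E" and "\<And>r e. r \<in> R \<Longrightarrow> e \<in> E \<Longrightarrow> a r e \<in> A"
    and "indep_columns R E (\<lambda>r e. a r e x0)"
  shows "eventually (\<lambda>x. indep_columns R E (\<lambda>r e. a r e x)) F"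
  using assms(4-6)
proof (induction E arbitrary: a rule: finite_induct)
  case empty
  then show ?case by (simp add: indep_columns_def)
next
  case (insert e E)
  obtain r0 where r0: "r0 \<in> R" "a r0 e x0 \<noteq> 0"
    using indep_columns_pivot[OF insert.prems(2), of e] insert.hyps by auto
  let ?b = "\<lambda>r e' x. a r0 e x * a r e' x - a r e x * a r0 e' x"
  note elim = indep_columns_eliminate[OF insert.hyps r0(1), of "\<lambda>r e. a r e x" for x]
  have "eventually (\<lambda>x. indep_columns R E (\<lambda>r e. ?b r e x)) F"
  proof (rule insert.IH)
    show "?b r e' \<in> A" if "r \<in> R" "e' \<in> E" for r e'
      using that r0(1) insert.prems(1) by (intro diff mult) auto
    show "indep_columns R E (\<lambda>r e. ?b r e x0)"
      using insert.prems(2) elim[OF r0(2)] by blast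
  qed
  moreover have "eventually (\<lambda>x. a r0 e x \<noteq> 0) F"
    using nz r0 insert.prems(1) by blast
  ultimately show ?case by eventually_elim (simp add: elim)
qed

text \<open>The pivots are polynomials in \<open>t\<close> that do not vanish at \<open>t0\<close>,
  and each of them has finitely many roots.\<close>

lemma finite_not_indep_columns:
  fixes a b :: "'r \<Rightarrow> 'e \<Rightarrow> real"
  assumes "finite E" and "indep_columns R E (\<lambda>r e. a r e + t0 * b r e)"
  shows "finite {t. \<not> indep_columns R E (\<lambda>r e. a r e + t * b r e)}"
proof -
  have "eventually (\<lambda>t. indep_columns R E (\<lambda>r e. a r e + t * b r e)) cofinite"
  proof (rule eventually_indep_columns[where A = "range poly" and ?x0.0 = t0])
    show "(\<lambda>x. p x * q x) \<in> range poly" if pq: "p \<in> range poly" "q \<in> range poly" for p q :: "real \<Rightarrow> real"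
      proof -
      obtain p' q' where "p = poly p'" "q = poly q'" using pq by blast
      then show ?thesis by (intro range_eqI[of _ _ "p' * q'"]) auto
    qed
    show "(\<lambda>x. p x - q x) \<in> range poly" if pq: "p \<in> range poly" "q \<in> range poly" for p q :: "real \<Rightarrow> real"
      proof -
      obtain p' q' where "p = poly p'" "q = poly q'" using pq by blast
      then show ?thesis by (intro range_eqI[of _ _ "p' - q'"]) auto
    qed
    show "eventually (\<lambda>x. p x \<noteq> 0) cofinite" if "p \<in> range poly" "p t0 \<noteq> 0" for p :: "real \<Rightarrow> real"
      using that by (auto simp: eventually_cofinite intro!: poly_roots_finite)
    show "(\<lambda>t. a r e + t * b r e) \<in> range poly" for r e
      by (rule range_eqI[of _ _ "[:a r e, b r e:]"]) auto
  qed (use assms in auto)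
  then show ?thesis by (simp add: eventually_cofinite)
qed

section \<open>The rigidity matrix\<close>

lemma simple_graph_edgeE:
  assumes "simple_graph G" "e \<in> edges G"
  obtains u v where "e = {u, v}" "u \<noteq> v" "u \<in> verts G" "v \<in> verts G"
  using assms unfolding simple_graph_def by blast

lemma simple_graph_edgeD:
  assumes "simple_graph G" "{u, v} \<in> edges G"
  shows "u \<noteq> v" "u \<in> verts G" "v \<in> verts G"
  by (rule simple_graph_edgeE[OF assms]; auto simp: doubleton_eq_iff)+

lemma simple_graph_edge_subset: "simple_graph G \<Longrightarrow> e \<in> edges G \<Longrightarrow> e \<subseteq> verts G"
  by (auto elim: simple_graph_edgeE)

lemma finite_verts: "simple_graph G \<Longrightarrow> finite (verts G)"
  by (simp add: simple_graph_def)

lemma finite_edges: "simple_graph G \<Longrightarrow> finite (edges G)"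
  by (meson PowI finite_Pow_iff finite_subset finite_verts simple_graph_edge_subset subsetI)

text \<open>The entry for an edge \<open>{v, u}\<close> in row \<open>(v, i)\<close> is \<open>f v i - f u i\<close>, written
  without naming the other end.\<close>

definition rigidity_matrix :: "('a \<Rightarrow> nat \<Rightarrow> real) \<Rightarrow> 'a \<times> nat \<Rightarrow> 'a set \<Rightarrow> real" where
  "rigidity_matrix f = (\<lambda>(v, i) e. if v \<in> e then 2 * f v i - (\<Sum>x\<in>e. f x i) else 0)"

lemma rigidity_matrix_edge:
  "v \<noteq> u \<Longrightarrow> rigidity_matrix f (v, i) {v, u} = f v i - f u i"
  by (auto simp: rigidity_matrix_def)

lemma rigidity_matrix_notin: "v \<notin> e \<Longrightarrow> rigidity_matrix f (v, i) e = 0"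
  by (simp add: rigidity_matrix_def)

lemma rigidity_matrix_line:
  "rigidity_matrix (\<lambda>v i. (1 - t) * f v i + t * g v i) r e =
   rigidity_matrix f r e + t * (rigidity_matrix g r e - rigidity_matrix f r e)"
  by (auto simp: rigidity_matrix_def split_beta algebra_simps sum.distrib sum_subtractf
      simp flip: sum_distrib_left)

lemma rigidity_matrix_cong:
  assumes "\<And>x. x \<in> e \<Longrightarrow> f x i = g x i"
  shows "rigidity_matrix f (v, i) e = rigidity_matrix g (v, i) e"
  using assms by (simp add: rigidity_matrix_def cong: sum.cong)

lemma neighbour_sum_eq_edge_sum:
  assumes "simple_graph G"
  shows "(\<Sum>u | {v, u} \<in> edges G. w {v, u} * (f v i - f u i)) =
         (\<Sum>e\<in>edges G. w e * rigidity_matrix f (v, i) e)"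
proof -
  have "(\<Sum>e\<in>edges G. w e * rigidity_matrix f (v, i) e) =
        (\<Sum>e\<in>{e \<in> edges G. v \<in> e}. w e * rigidity_matrix f (v, i) e)"
    using assms by (intro sum.mono_neutral_right) (auto simp: finite_edges rigidity_matrix_notin)
  also have "{e \<in> edges G. v \<in> e} = (\<lambda>u. {v, u}) ` {u. {v, u} \<in> edges G}"
  proof (intro equalityI subsetI)
    fix e assume "e \<in> {e \<in> edges G. v \<in> e}"
    then have e: "e \<in> edges G" "v \<in> e" by auto
    then obtain a b where ab: "e = {a, b}" using assms by (blast elim: simple_graph_edgeE)
    with e consider "e = {v, a}" | "e = {v, b}" by blast
    then show "e \<in> (\<lambda>u. {v, u}) ` {u. {v, u} \<in> edges G}" using e by cases auto
  qed auto
  also have "(\<Sum>e\<in>\<dots>. w e * rigidity_matrix f (v, i) e) =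
      (\<Sum>u | {v, u} \<in> edges G. w {v, u} * rigidity_matrix f (v, i) {v, u})"
    by (subst sum.reindex) (auto simp: inj_on_def doubleton_eq_iff)
  also have "\<dots> = (\<Sum>u | {v, u} \<in> edges G. w {v, u} * (f v i - f u i))"
    by (intro sum.cong refl) (simp add: rigidity_matrix_edge simple_graph_edgeD(1)[OF assms])
  finally show ?thesis by simp
qed

lemma stress_free_iff_indep_columns:
  assumes "simple_graph G"
  shows "stress_free d G f \<longleftrightarrow>
         indep_columns (verts G \<times> {..<d}) (edges G) (rigidity_matrix f)"
  unfolding stress_free_def is_stress_def indep_columns_def neighbour_sum_eq_edge_sum[OF assms]
  by auto

lemma stress_free_cong:
  assumes "simple_graph G" "\<And>v i. v \<in> verts G \<Longrightarrow> i < d \<Longrightarrow> f v i = g v i"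
  shows "stress_free d G f \<longleftrightarrow> stress_free d G g"
  unfolding stress_free_iff_indep_columns[OF assms(1)]
  using simple_graph_edge_subset[OF assms(1)]
  by (intro indep_columns_cong) (auto intro!: rigidity_matrix_cong assms(2))

text \<open>The matrix is affine in \<open>t\<close>, and its columns are independent at
  \<open>t = 1\<close>, where the line passes through \<open>g\<close>; the point \<open>f\<close>
  at \<open>t = 0\<close> is arbitrary.\<close>

lemma finite_not_stress_free_line:
  assumes "simple_graph G" and "stress_free d G g"
  shows "finite {t. \<not> stress_free d G (\<lambda>v i. (1 - t) * f v i + t * g v i)}"
  unfolding stress_free_iff_indep_columns[OF assms(1)] rigidity_matrix_line
  by (rule finite_not_indep_columns[where ?t0.0 = 1])
     (use assms in \<open>auto simp: finite_edges stress_free_iff_indep_columns\<close>)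

text \<open>Matrix entries depend continuously on the embedding, so the pivots of an elimination at
  \<open>f\<close> stay nonzero in a neighbourhood of \<open>f\<close>.\<close>

lemma openin_stress_free:
  assumes G: "simple_graph G"
  shows "openin (embedding_space d G) {f \<in> topspace (embedding_space d G). stress_free d G f}"
    (is "openin ?X ?S")
proof (subst openin_subopen, intro ballI)
  fix f assume f: "f \<in> ?S"
  have coord: "continuous_map ?X euclideanreal (\<lambda>f. f v i)" if "v \<in> verts G" for v i
  proof -
    have "continuous_map ?X (Euclidean_space d) (\<lambda>f. f v)"
      unfolding embedding_space_def by (rule continuous_map_product_projection[OF that])
    then have "continuous_map ?X (powertop_real UNIV) (\<lambda>f. f v)"
      unfolding Euclidean_space_def by (simp add: continuous_map_in_subtopology)
    then show ?thesis by (simp add: continuous_map_componentwise_UNIV)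
  qed
  let ?C = "{p. continuous_map ?X euclideanreal p}"
  have "eventually (\<lambda>g. indep_columns (verts G \<times> {..<d}) (edges G) (\<lambda>r e. rigidity_matrix g r e))
          (nhdsin ?X f)"
  proof (rule eventually_indep_columns[where A = ?C and ?x0.0 = f])
    show "(\<lambda>x. p x * q x) \<in> ?C" "(\<lambda>x. p x - q x) \<in> ?C" if "p \<in> ?C" "q \<in> ?C" for p q
      using that by (auto intro: continuous_map_real_mult continuous_map_diff)
    show "eventually (\<lambda>g. p g \<noteq> 0) (nhdsin ?X f)"
      if "p \<in> ?C" "p f \<noteq> 0" for p
      unfolding eventually_nhdsin
      using that f openin_continuous_map_preimage[of ?X euclideanreal p "- {0}"]
      by (intro disjI2 exI[of _ "{x \<in> topspace ?X. p x \<in> - {0}}"]) auto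
    show "(\<lambda>g. rigidity_matrix g r e) \<in> ?C"
      if re: "r \<in> verts G \<times> {..<d}" "e \<in> edges G" for r e
    proof -
      obtain v i where r: "r = (v, i)" "v \<in> verts G" using re by auto
      have e: "e \<subseteq> verts G" "finite e"
        using simple_graph_edge_subset[OF G re(2)] finite_verts[OF G] finite_subset by auto
      show ?thesis
        unfolding r rigidity_matrix_def using r(2) e
        by (cases "v \<in> e")
          (auto intro!: continuous_map_diff continuous_map_real_mult continuous_map_sum coord)
    qed
    show "indep_columns (verts G \<times> {..<d}) (edges G) (rigidity_matrix f)"
      using f stress_free_iff_indep_columns[OF G] by blast
  qed (rule finite_edges[OF G])
  then have "eventually (stress_free d G) (nhdsin ?X f)"
    by (rule eventually_mono) (simp add: stress_free_iff_indep_columns[OF G])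
  then obtain T where T: "openin ?X T" "f \<in> T" "\<forall>g\<in>T. stress_free d G g"
    using f by (auto simp: eventually_nhdsin)
  then show "\<exists>T. openin ?X T \<and> f \<in> T \<and> T \<subseteq> ?S"
    using openin_subset[OF T(1)] by (intro exI[of _ T]) auto
qed

text \<open>The line from any \<open>f\<close> to \<open>g\<close> meets only finitely many
  embeddings with a nonzero stress, but it lies in a given neighbourhood of \<open>f\<close> for
  infinitely many parameters near 0.\<close>

lemma dense_stress_free:
  assumes G: "simple_graph G" and g: "stress_free d G g"
  shows "embedding_space d G closure_of {f \<in> topspace (embedding_space d G). stress_free d G f} =
         topspace (embedding_space d G)" (is "?X closure_of ?S = _")
proof (intro equalityI closure_of_subset_topspace subsetI)
  fix f assume f: "f \<in> topspace ?X"
  have f0: "f v i = 0" if "v \<in> verts G" "d \<le> i" for v i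
    using f that by (auto simp: embedding_space_def topspace_Euclidean_space PiE_def Pi_def)
  \<comment> \<open>\<open>g\<close> need not be a point of the embedding space. Cutting off the
    coordinates from \<open>d\<close> on and restricting to the vertex set keeps the path inside it
    without changing the stresses.\<close>
  define l where "l = (\<lambda>t. restrict (\<lambda>v i. if i < d then (1 - t) * f v i + t * g v i else 0) (verts G))"
  have l: "continuous_map euclideanreal ?X l"
    unfolding embedding_space_def continuous_map_componentwise
  proof (intro conjI ballI)
    show "l ` topspace euclideanreal \<subseteq> extensional (verts G)" by (auto simp: l_def)
    fix v assume v: "v \<in> verts G"
    show "continuous_map euclideanreal (Euclidean_space d) (\<lambda>t. l t v)"
      using v by (auto simp: l_def continuous_map_componentwise_Euclidean_space intro!: continuous_intros)
  qed
  have sf: "stress_free d G (l t) \<longleftrightarrow> stress_free d G (\<lambda>v i. (1 - t) * f v i + t * g v i)" for t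
    by (rule stress_free_cong[OF G]) (simp add: l_def)
  have lf: "l 0 = f"
    using f f0 by (auto simp: l_def embedding_space_def fun_eq_iff PiE_def extensional_def)
  show "f \<in> ?X closure_of ?S"
    unfolding in_closure_of
  proof (intro conjI f allI impI)
    fix T assume T: "f \<in> T \<and> openin ?X T"
    have "open {t. l t \<in> T}"
      using openin_continuous_map_preimage[OF l] T by simp
    moreover have "0 \<in> {t. l t \<in> T}" using lf T by simp
    ultimately have "infinite {t. l t \<in> T}"
      using finite_imp_not_open by blast
    then obtain t where "l t \<in> T" "stress_free d G (l t)"
      using finite_not_stress_free_line[OF G g, of f] unfolding sf[symmetric]
      by (metis (mono_tags, lifting) mem_Collect_eq rev_finite_subset subsetI)
    moreover have "l t \<in> topspace ?X" using l by (auto simp: continuous_map_def)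
    ultimately show "\<exists>y. y \<in> ?S \<and> y \<in> T" by blast
  qed
qed

lemma generically_stress_freeI:
  assumes "simple_graph G" "stress_free d G f"
  shows "generically_stress_free d G"
  unfolding generically_stress_free_def Let_def
  using openin_stress_free dense_stress_free assms by blast

text \<open>An edge has opposite entries at its two ends, so for each coordinate the rows of all
  vertices sum to zero. The \<open>d\<close> rows of one vertex \<open>x0\<close> are therefore
  redundant, and rows outside \<open>X\<close> are zero. Hence the rank is at most
  \<open>d * (card X - 1)\<close>.\<close>

lemma card_edges_le_if_stress_free:
  assumes G: "simple_graph G" and sf: "stress_free d G f"
    and X: "finite X" "X \<noteq> {}" "\<Union>(edges G) \<subseteq> X"
  shows "card (edges G) \<le> d * (card X - 1)"
proof -
  obtain x0 where x0: "x0 \<in> X" using X(2) by blast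
  have "indep_columns ((X - {x0}) \<times> {..<d}) (edges G) (rigidity_matrix f)"
    unfolding indep_columns_def
  proof (intro allI impI)
    fix w assume w: "\<forall>r\<in>(X - {x0}) \<times> {..<d}. (\<Sum>e\<in>edges G. w e * rigidity_matrix f r e) = 0"
    have all: "(\<Sum>e\<in>edges G. w e * rigidity_matrix f (v, i) e) = 0" if "i < d" for v i
    proof -
      consider "v \<in> X - {x0}" | "v = x0" | "v \<notin> X" by blast
      then show ?thesis
      proof cases
        case 1
        then show ?thesis using w that by blast
      next
        case 2
        have col: "(\<Sum>v\<in>X. rigidity_matrix f (v, i) e) = 0" if e: "e \<in> edges G" for e
        proof -
          obtain a b where ab: "e = {a, b}" "a \<noteq> b" using e G by (blast elim: simple_graph_edgeE)
          have "(\<Sum>v\<in>X. rigidity_matrix f (v, i) e) = (\<Sum>v\<in>e. rigidity_matrix f (v, i) e)"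
            using X e by (intro sum.mono_neutral_right) (auto simp: rigidity_matrix_notin)
          then show ?thesis using ab by (simp add: rigidity_matrix_def)
        qed
        have "0 = (\<Sum>e\<in>edges G. w e * (\<Sum>v\<in>X. rigidity_matrix f (v, i) e))"
          by (simp add: col)
        also have "\<dots> = (\<Sum>v\<in>X. \<Sum>e\<in>edges G. w e * rigidity_matrix f (v, i) e)"
          unfolding sum_distrib_left by (rule sum.swap)
        also have "\<dots> = (\<Sum>e\<in>edges G. w e * rigidity_matrix f (x0, i) e)"
          using w that X(1) x0 by (subst sum.remove[of _ x0]) auto
        finally show ?thesis using 2 by simp
      next
        case 3
        then have "v \<notin> e" if "e \<in> edges G" for e using that X(3) by blast
        then show ?thesis
          by (simp add: rigidity_matrix_notin)
      qed
    qed
    then show "\<forall>e\<in>edges G. w e = 0"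
      using sf unfolding stress_free_iff_indep_columns[OF G] indep_columns_def by blast
  qed
  from card_le_if_indep_columns[OF _ _ this] show ?thesis
    using G X(1) x0 by (simp add: finite_edges mult.commute)
qed

section \<open>Splitting a contracted edge\<close>

text \<open>An edge has two distinct ends, so \<open>{v, u}\<close> alone can collapse to the loop
  \<open>{v}\<close>.\<close>

lemma edges_contract:
  assumes G: "simple_graph G" and vu: "{v, u} \<in> edges G"
  shows "edges (contract v u G) = (\<lambda>e. id(u := v) ` e) ` (edges G - {{v, u}})"
proof -
  have "id(u := v) ` e = {v} \<longleftrightarrow> e = {v, u}" if e: "e \<in> edges G" for e
  proof -
    obtain a b where "e = {a, b}" "a \<noteq> b" using G e by (rule simple_graph_edgeE)
    then show ?thesis by (auto simp: doubleton_eq_iff split: if_splits)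
  qed
  then show ?thesis unfolding contract_def by auto
qed

lemma verts_contract:
  assumes "simple_graph G" "{v, u} \<in> edges G"
  shows "verts (contract v u G) = verts G - {u}"
  using simple_graph_edgeD[OF assms] by (auto simp: contract_def image_iff)

lemma simple_graph_contract:
  assumes G: "simple_graph G" and vu: "{v, u} \<in> edges G"
  shows "simple_graph (contract v u G)"
  unfolding simple_graph_def
proof (intro conjI subsetI)
  show "finite (verts (contract v u G))"
    using finite_verts[OF G] by (simp add: contract_def)
  fix e' assume "e' \<in> edges (contract v u G)"
  then obtain e where e: "e \<in> edges G" "e \<noteq> {v, u}" "e' = id(u := v) ` e"
    unfolding edges_contract[OF assms] by blast
  obtain a b where ab: "e = {a, b}" "a \<noteq> b" "a \<in> verts G" "b \<in> verts G"
    using G e(1) by (rule simple_graph_edgeE)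
  have "e' = {(id(u := v)) a, (id(u := v)) b}" "(id(u := v)) a \<noteq> (id(u := v)) b"
    using ab e by (auto simp: doubleton_eq_iff)
  moreover have "(id(u := v)) a \<in> verts (contract v u G)" "(id(u := v)) b \<in> verts (contract v u G)"
    using ab by (simp_all add: contract_def)
  ultimately show "e' \<in> {{a, b} |a b. a \<in> verts (contract v u G) \<and> b \<in> verts (contract v u G) \<and> a \<noteq> b}"
    by blast
qed

lemma card_edges_contract_less:
  assumes "simple_graph G" "{v, u} \<in> edges G"
  shows "card (edges (contract v u G)) < card (edges G)"
proof -
  have "card (edges (contract v u G)) \<le> card (edges G - {{v, u}})"
    unfolding edges_contract[OF assms] by (intro card_image_le finite_Diff finite_edges assms)
  also have "\<dots> < card (edges G)"
    using assms by (intro card_Diff1_less finite_edges)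
  finally show ?thesis .
qed

text \<open>\<open>f \<circ> id(u := v)\<close> is the embedding of the larger graph with
  \<open>u\<close> placed on top of \<open>v\<close>. The edge contains at most one of
  \<open>v\<close> and \<open>u\<close>; if it moves from \<open>u\<close> to \<open>v\<close>, its
  entry moves from row \<open>u\<close> to row \<open>v\<close>.\<close>

lemma rigidity_matrix_merge:
  assumes "a \<noteq> b" "{a, b} \<noteq> {v, u}" "v \<noteq> u" and e: "e = {a, b}"
  shows "x \<noteq> u \<Longrightarrow> x \<noteq> v \<Longrightarrow>
      rigidity_matrix f (x, i) (id(u := v) ` e) = rigidity_matrix (f \<circ> id(u := v)) (x, i) e"
    and "rigidity_matrix f (v, i) (id(u := v) ` e) =
      rigidity_matrix (f \<circ> id(u := v)) (v, i) e + rigidity_matrix (f \<circ> id(u := v)) (u, i) e"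
  unfolding e using assms(1-3) by (auto simp: rigidity_matrix_def doubleton_eq_iff)

text \<open>Each of the two properties holds off finitely many points of the line that joins the
  given stress-free \<open>f\<close> to an embedding \<open>g\<close> with the second
  property.\<close>

lemma ex_stress_free_and_indep:
  fixes f :: "'a \<Rightarrow> nat \<Rightarrow> real"
  assumes G: "simple_graph G" and f: "stress_free d G f"
    and C: "finite C" "v \<notin> C" "card C \<le> d"
  shows "\<exists>f. stress_free d G f \<and> indep_columns {..<d} C (\<lambda>i x. f v i - f x i)"
proof -
  obtain k where k: "k ` C \<subseteq> {..<d}" "inj_on k C"
    using card_le_inj[of C "{..<d}"] C by auto
  \<comment> \<open>\<open>v\<close> sits at the origin and the points of \<open>C\<close> at
    distinct unit vectors, of which there are enough since \<open>card C \<le> d\<close>.\<close>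
  define g :: "'a \<Rightarrow> nat \<Rightarrow> real" where "g = (\<lambda>x i. if x \<noteq> v \<and> i = k x then 1 else 0)"
  let ?l = "\<lambda>t x i. (1 - t) * g x i + t * f x i"
  have "indep_columns {..<d} C (\<lambda>i x. g v i - g x i)"
    unfolding indep_columns_def
  proof (intro allI impI ballI)
    fix w x assume w: "\<forall>i\<in>{..<d}. (\<Sum>x\<in>C. w x * (g v i - g x i)) = 0" and x: "x \<in> C"
    have "(\<Sum>y\<in>C. w y * (g v (k x) - g y (k x))) = (\<Sum>y\<in>C. if y = x then - w x else 0)"
      using C(2) x k(2) by (intro sum.cong) (auto simp: g_def inj_on_def)
    also have "\<dots> = - w x" using C(1) x by simp
    finally show "w x = 0" using w k x by auto
  qed
  then have "finite {t. \<not> indep_columns {..<d} C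
      (\<lambda>i x. (g v i - g x i) + t * ((f v i - f x i) - (g v i - g x i)))}"
    using C(1) by (intro finite_not_indep_columns[where ?t0.0 = 0]) simp_all
  moreover have "(g v i - g x i) + t * ((f v i - f x i) - (g v i - g x i)) = ?l t v i - ?l t x i"
    for t i x by (simp add: algebra_simps)
  ultimately have "finite ({t. \<not> stress_free d G (?l t)} \<union>
      {t. \<not> indep_columns {..<d} C (\<lambda>i x. ?l t v i - ?l t x i)})"
    using finite_not_stress_free_line[OF G f, of g] by simp
  then obtain t where "t \<notin> {t. \<not> stress_free d G (?l t)} \<union>
      {t. \<not> indep_columns {..<d} C (\<lambda>i x. ?l t v i - ?l t x i)}"
    using ex_new_if_finite[OF infinite_UNIV_char_0] by blast
  then show ?thesis by (intro exI[of _ "?l t"]) auto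
qed

text \<open>In the limit \<open>t \<rightarrow> 0\<close> of the embeddings in which \<open>u\<close> moves along a fixed
  direction into \<open>v\<close>, the columns of the rigidity matrix (that of \<open>{v, u}\<close> rescaled by
  \<open>1 / t\<close>) are the ones below.\<close>

lemma indep_columns_limit:
  fixes f :: "'a \<Rightarrow> nat \<Rightarrow> real"
  assumes G: "simple_graph G" and vu: "{v, u} \<in> edges G"
    and f: "stress_free d (contract v u G) f"
    and ind: "indep_columns {..<d} (insert u {x. {v, x} \<in> edges G \<and> {u, x} \<in> edges G})
      (\<lambda>i x. f v i - f x i)"
  shows "indep_columns (verts G \<times> {..<d}) (edges G)
    (\<lambda>r e. rigidity_matrix (if e = {v, u} then f else f \<circ> id(u := v)) r e)"
    (is "indep_columns _ _ ?a")
  unfolding indep_columns_def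
proof (intro allI impI)
  fix w assume w: "\<forall>r\<in>verts G \<times> {..<d}. (\<Sum>e\<in>edges G. w e * ?a r e) = 0"
  define E where "E = edges G - {{v, u}}"
  define h where "h = id(u := v)"
  let ?C = "{x. {v, x} \<in> edges G \<and> {u, x} \<in> edges G}"
  \<comment> \<open>The push-forward of \<open>w\<close> to the contraction, where weights of
    parallel edges add up. It turns out to be a stress with respect to \<open>f\<close>, hence it is
    zero on the edges.\<close>
  define w' where "w' = (\<lambda>e'. \<Sum>e | e \<in> E \<and> h ` e = e'. w e)"
  have G': "simple_graph (contract v u G)" by (rule simple_graph_contract[OF G vu])
  have finE: "finite E" unfolding E_def using G by (simp add: finite_edges)
  have vu': "v \<noteq> u" "v \<in> verts G" "u \<in> verts G" using simple_graph_edgeD[OF G vu] by auto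
  have E': "edges (contract v u G) = (\<lambda>e. h ` e) ` E"
    unfolding E_def h_def by (rule edges_contract[OF G vu])
  have edge: "\<exists>a b. e = {a, b} \<and> a \<noteq> b" if "e \<in> edges G" for e
    by (rule simple_graph_edgeE[OF G that]) blast
  have wz: "(\<Sum>e\<in>edges G. w e * ?a (x, i) e) = 0" if "x \<in> verts G" "i < d" for x i
    using w that by (intro w[rule_format]) simp
  have split: "(\<Sum>e\<in>edges G. w e * ?a r e) =
      w {v, u} * rigidity_matrix f r {v, u} + (\<Sum>e\<in>E. w e * rigidity_matrix (f \<circ> h) r e)" for r
  proof -
    have "(\<Sum>e\<in>edges G. w e * ?a r e) = w {v, u} * ?a r {v, u} + (\<Sum>e\<in>E. w e * ?a r e)"
      unfolding E_def by (rule sum.remove[OF finite_edges[OF G] vu])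
    also have "(\<Sum>e\<in>E. w e * ?a r e) = (\<Sum>e\<in>E. w e * rigidity_matrix (f \<circ> h) r e)"
      unfolding E_def h_def by (intro sum.cong refl) simp
    finally show ?thesis by simp
  qed
  have push: "(\<Sum>e'\<in>edges (contract v u G). w' e' * rigidity_matrix f r e') =
      (\<Sum>e\<in>E. w e * rigidity_matrix f r (h ` e))" for r
  proof -
    have "(\<Sum>e'\<in>edges (contract v u G). w' e' * rigidity_matrix f r e') =
        (\<Sum>e'\<in>edges (contract v u G). \<Sum>e | e \<in> E \<and> h ` e = e'. w e * rigidity_matrix f r (h ` e))"
      by (intro sum.cong refl) (simp add: w'_def sum_distrib_right)
    also have "\<dots> = (\<Sum>e\<in>E. w e * rigidity_matrix f r (h ` e))"
      unfolding E' by (rule sum.group[OF finE finite_imageI[OF finE] order_refl])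
    finally show ?thesis .
  qed
  have "(\<Sum>e\<in>E. w e * rigidity_matrix f (x, i) (h ` e)) = 0" if x: "x \<in> verts G - {u}" "i < d" for x i
  proof (cases "x = v")
    case False
    then have "(\<Sum>e\<in>E. w e * rigidity_matrix f (x, i) (h ` e)) =
        (\<Sum>e\<in>E. w e * rigidity_matrix (f \<circ> h) (x, i) e)"
    proof (intro sum.cong refl)
      fix e assume e: "e \<in> E"
      then have "e \<in> edges G" by (simp add: E_def)
      then obtain a b where ab: "e = {a, b}" "a \<noteq> b" using edge by blast
      have "{a, b} \<noteq> {v, u}" using e ab(1) unfolding E_def by blast
      then have "rigidity_matrix f (x, i) (h ` e) = rigidity_matrix (f \<circ> h) (x, i) e"
        unfolding h_def using rigidity_matrix_merge(1)[OF ab(2) _ vu'(1) ab(1)] x False by blast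
      then show "w e * rigidity_matrix f (x, i) (h ` e) = w e * rigidity_matrix (f \<circ> h) (x, i) e"
        by (rule arg_cong)
    qed
    also have "\<dots> = (\<Sum>e\<in>edges G. w e * ?a (x, i) e)"
    proof -
      have "rigidity_matrix f (x, i) {v, u} = 0"
        using x False by (intro rigidity_matrix_notin) auto
      then show ?thesis unfolding split by simp
    qed
    also have "\<dots> = 0" using x by (intro wz) auto
    finally show ?thesis .
  next
    case True
    have "(\<Sum>e\<in>E. w e * rigidity_matrix f (v, i) (h ` e)) =
        (\<Sum>e\<in>E. w e * rigidity_matrix (f \<circ> h) (v, i) e + w e * rigidity_matrix (f \<circ> h) (u, i) e)"
    proof (intro sum.cong refl)
      fix e assume e: "e \<in> E"
      then have "e \<in> edges G" by (simp add: E_def)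
      then obtain a b where ab: "e = {a, b}" "a \<noteq> b" using edge by blast
      have "{a, b} \<noteq> {v, u}" using e ab(1) unfolding E_def by blast
      then have merge: "rigidity_matrix f (v, i) (h ` e) =
          rigidity_matrix (f \<circ> h) (v, i) e + rigidity_matrix (f \<circ> h) (u, i) e"
        unfolding h_def by (rule rigidity_matrix_merge(2)[OF ab(2) _ vu'(1) ab(1)])
      show "w e * rigidity_matrix f (v, i) (h ` e) =
          w e * rigidity_matrix (f \<circ> h) (v, i) e + w e * rigidity_matrix (f \<circ> h) (u, i) e"
        unfolding merge by (rule distrib_left)
    qed
    \<comment> \<open>The entries of \<open>{v, u}\<close> in the rows of \<open>v\<close> and
      \<open>u\<close> are opposite and cancel.\<close>
    also have "\<dots> = (\<Sum>e\<in>edges G. w e * ?a (v, i) e) + (\<Sum>e\<in>edges G. w e * ?a (u, i) e)"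
    proof -
      have "rigidity_matrix f (u, i) {v, u} = - rigidity_matrix f (v, i) {v, u}"
        using rigidity_matrix_edge[of v u f i] rigidity_matrix_edge[of u v f i] vu'(1)
        by (simp add: insert_commute)
      then show ?thesis unfolding split by (simp add: sum.distrib)
    qed
    also have "\<dots> = 0" unfolding wz[OF vu'(2) x(2)] wz[OF vu'(3) x(2)] by simp
    finally show ?thesis unfolding True .
  qed
  then have "\<forall>r\<in>verts (contract v u G) \<times> {..<d}.
      (\<Sum>e'\<in>edges (contract v u G). w' e' * rigidity_matrix f r e') = 0"
    unfolding verts_contract[OF G vu] push by auto
  then have w'0: "w' (h ` e) = 0" if "e \<in> E" for e
    using f that unfolding stress_free_iff_indep_columns[OF G'] indep_columns_def E' by blast
  have fiber: "w e = 0" if "e \<in> E" "\<And>e'. e' \<in> E \<Longrightarrow> h ` e' = h ` e \<Longrightarrow> e' = e" for e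
  proof -
    have "{e'. e' \<in> E \<and> h ` e' = h ` e} = {e}" using that by blast
    then show ?thesis using w'0[OF that(1)] by (simp add: w'_def)
  qed
  have h_fiber: "e = {v, x} \<or> e = {u, x}" if e: "e \<in> E" and "h ` e = {v, x}" "x \<noteq> v" "x \<noteq> u" for e x
  proof -
    have "e \<in> edges G" using e by (simp add: E_def)
    then obtain a b where "e = {a, b}" "a \<noteq> b" using edge by blast
    then show ?thesis using that by (auto simp: h_def doubleton_eq_iff split: if_splits)
  qed
  have h_img: "h ` {v, x} = {v, x}" "h ` {u, x} = {v, x}" if "x \<noteq> v" "x \<noteq> u" for x
    using that by (auto simp: h_def)
  have E_iff: "{v, x} \<in> E \<longleftrightarrow> {v, x} \<in> edges G \<and> x \<noteq> u" "{u, x} \<in> E \<longleftrightarrow> {u, x} \<in> edges G \<and> x \<noteq> v" for x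
    using vu' by (auto simp: E_def doubleton_eq_iff)
  \<comment> \<open>Such an edge has no parallel copy after the contraction, so the vanishing fibre
    sum is its own weight.\<close>
  have not_common: "w {v, x} = 0" if "{v, x} \<in> edges G" "x \<noteq> u" "{u, x} \<notin> edges G" for x
  proof -
    have "x \<noteq> v" using simple_graph_edgeD[OF G that(1)] by simp
    then show ?thesis
      using h_fiber[of _ x] that E_iff[of x] h_img(1)[of x] by (intro fiber) (blast, metis)
  qed
  have C_sub: "x \<noteq> u \<and> x \<noteq> v" if "x \<in> ?C" for x using that simple_graph_edgeD[OF G] by blast
  \<comment> \<open>In the row of \<open>v\<close> only \<open>{v, u}\<close> and the edges to
    common neighbours are left; their directions are independent by assumption.\<close>
  have star: "(\<Sum>x\<in>insert u ?C. w {v, x} * (f v i - f x i)) = 0" if "i < d" for i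
  proof -
    have "(\<Sum>x\<in>insert u ?C. w {v, x} * (f v i - f x i)) =
        (\<Sum>x\<in>insert u ?C. w {v, x} * ?a (v, i) {v, x})"
    proof (intro sum.cong refl)
      fix x assume "x \<in> insert u ?C"
      then have "x = u \<or> x \<noteq> u \<and> x \<noteq> v" using C_sub by blast
      then show "w {v, x} * (f v i - f x i) = w {v, x} * ?a (v, i) {v, x}"
        using vu' by (auto simp: rigidity_matrix_edge doubleton_eq_iff)
    qed
    also have "\<dots> = (\<Sum>e\<in>(\<lambda>x. {v, x}) ` insert u ?C. w e * ?a (v, i) e)"
      by (subst sum.reindex) (auto simp: inj_on_def doubleton_eq_iff)
    also have "\<dots> = (\<Sum>e\<in>edges G. w e * ?a (v, i) e)"
    proof (intro sum.mono_neutral_left finite_edges G ballI)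
      show "(\<lambda>x. {v, x}) ` insert u ?C \<subseteq> edges G" using vu by auto
      fix e assume e: "e \<in> edges G - (\<lambda>x. {v, x}) ` insert u ?C"
      show "w e * ?a (v, i) e = 0"
      proof (cases "v \<in> e")
        case True
        then obtain x where x: "e = {v, x}" using edge[of e] e by auto
        then have "w e = 0" using e by (auto intro!: not_common)
        then show ?thesis by simp
      qed (simp add: rigidity_matrix_notin)
    qed
    also have "\<dots> = 0" using vu' that by (intro wz)
    finally show ?thesis .
  qed
  then have common: "w {v, x} = 0" if "x \<in> insert u ?C" for x
    using ind[unfolded indep_columns_def, rule_format, of "\<lambda>x. w {v, x}"] that by simp
  have wv: "w {v, x} = 0" if "{v, x} \<in> edges G" for x
    using common[of x] not_common[of x] that by blast
  \<comment> \<open>As all weights at \<open>v\<close> vanish, the fibre sum over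
    \<open>{v, x}\<close> reduces to the weight of \<open>{u, x}\<close>.\<close>
  have wu: "w {u, x} = 0" if ux: "{u, x} \<in> edges G" "x \<noteq> v" for x
  proof -
    have x: "x \<noteq> u" using simple_graph_edgeD[OF G ux(1)] by simp
    have "{e. e \<in> E \<and> h ` e = {v, x}} = insert {u, x} ({{v, x}} \<inter> E)"
    proof (intro equalityI subsetI)
      fix e assume "e \<in> {e. e \<in> E \<and> h ` e = {v, x}}"
      then show "e \<in> insert {u, x} ({{v, x}} \<inter> E)" using h_fiber[of e x] ux x by blast
    next
      fix e assume "e \<in> insert {u, x} ({{v, x}} \<inter> E)"
      then show "e \<in> {e. e \<in> E \<and> h ` e = {v, x}}" using h_img[of x] E_iff(2)[of x] ux x by blast
    qed
    moreover have "{u, x} \<notin> {{v, x}} \<inter> E" using vu' by (simp add: doubleton_eq_iff)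
    ultimately have "w' {v, x} = w {u, x} + (\<Sum>e\<in>{{v, x}} \<inter> E. w e)"
      unfolding w'_def by simp
    moreover have "(\<Sum>e\<in>{{v, x}} \<inter> E. w e) = 0"
      using wv by (intro sum.neutral) (auto simp: E_def)
    ultimately show ?thesis using w'0[of "{u, x}"] h_img(2)[of x] E_iff(2)[of x] ux x by simp
  qed
  show "\<forall>e\<in>edges G. w e = 0"
  proof
    fix e assume e: "e \<in> edges G"
    obtain a b where ab: "e = {a, b}" "a \<noteq> b" using edge e by blast
    show "w e = 0"
    proof (cases "u \<in> e \<or> v \<in> e")
      case True
      then consider x where "e = {v, x}" | x where "e = {u, x}" "x \<noteq> v" using ab by blast
      then show ?thesis using e wv wu by cases auto
    next
      case False
      then have "h ` e = e" by (auto simp: h_def)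
      moreover have "e' = e" if e': "e' \<in> E" "h ` e' = e" for e'
      proof -
        have "u \<notin> e'" using e' False by (force simp: h_def)
        then have "h ` e' = e'" by (force simp: h_def)
        then show ?thesis using e' by simp
      qed
      ultimately show ?thesis using e False by (intro fiber) (auto simp: E_def)
    qed
  qed
qed

text \<open>Fewer than \<open>d\<close> common neighbours together with \<open>u\<close> give at
  most \<open>d\<close> directions at \<open>v\<close>, which can be made independent. Independence
  of the limit columns then passes to all but finitely many of the embeddings in which
  \<open>u\<close> moves away from \<open>v\<close>.\<close>

lemma ex_stress_free_if_contract:
  assumes G: "simple_graph G" and vu: "{v, u} \<in> edges G"
    and sf: "stress_free d (contract v u G) f"
    and C: "card {x. {v, x} \<in> edges G \<and> {u, x} \<in> edges G} < d"
  shows "\<exists>g. stress_free d G g"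
proof -
  let ?C = "{x. {v, x} \<in> edges G \<and> {u, x} \<in> edges G}"
  have vu': "v \<noteq> u" using simple_graph_edgeD[OF G vu] by auto
  have "?C \<subseteq> verts G" "v \<notin> ?C" "u \<notin> ?C" using simple_graph_edgeD[OF G] by blast+
  then obtain f where f: "stress_free d (contract v u G) f"
      "indep_columns {..<d} (insert u ?C) (\<lambda>i x. f v i - f x i)"
    using ex_stress_free_and_indep[OF simple_graph_contract[OF G vu] sf, of "insert u ?C" v] C vu'
      finite_subset[OF _ finite_verts[OF G]] by auto
  define k where "k = f \<circ> id(u := v)"
  let ?a = "\<lambda>r e. rigidity_matrix (if e = {v, u} then f else k) r e"
  \<comment> \<open>\<open>k\<close> places \<open>u\<close> at \<open>v\<close> and otherwise
    agrees with \<open>f\<close>; \<open>?b\<close> is the derivative in \<open>t\<close> of the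
    columns. The column of \<open>{v, u}\<close> is constant because it has been divided by
    \<open>t\<close>.\<close>
  let ?b = "\<lambda>r e. if e = {v, u} then 0 else rigidity_matrix f r e - rigidity_matrix k r e"
  let ?g = "\<lambda>t x i. (1 - t) * k x i + t * f x i"
  let ?ok = "\<lambda>t. indep_columns (verts G \<times> {..<d}) (edges G) (\<lambda>r e. ?a r e + t * ?b r e)"
  have "finite {t. \<not> ?ok t}"
    using indep_columns_limit[OF G vu f, folded k_def] finite_edges[OF G]
    by (intro finite_not_indep_columns[where ?t0.0 = 0]) simp_all
  \<comment> \<open>At \<open>t = 0\<close> the ends of \<open>{v, u}\<close> coincide and the
    division by \<open>t\<close> cannot be undone.\<close>
  then have "finite (insert 0 {t. \<not> ?ok t})" by simp
  then obtain t where "t \<notin> insert 0 {t. \<not> ?ok t}"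
    using ex_new_if_finite[OF infinite_UNIV_char_0] by blast
  then have t: "t \<noteq> 0" "?ok t" by auto
  have "rigidity_matrix k r {v, u} = 0" for r
    using vu' by (cases r) (auto simp: rigidity_matrix_def k_def)
  then have g: "w e * rigidity_matrix (?g t) r e =
      (w({v, u} := t * w {v, u})) e * (?a r e + t * ?b r e)" for w r e
    unfolding rigidity_matrix_line by (cases "e = {v, u}") (simp_all add: algebra_simps)
  have "stress_free d G (?g t)"
    unfolding stress_free_iff_indep_columns[OF G] indep_columns_def g
  proof (intro allI impI)
    fix w assume "\<forall>r\<in>verts G \<times> {..<d}.
      (\<Sum>e\<in>edges G. (w({v, u} := t * w {v, u})) e * (?a r e + t * ?b r e)) = 0"
    then have "\<forall>e\<in>edges G. (w({v, u} := t * w {v, u})) e = 0"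
      using t(2) unfolding indep_columns_def by blast
    then show "\<forall>e\<in>edges G. w e = 0" using t(1) by (auto split: if_splits)
  qed
  then show ?thesis by blast
qed

section \<open>Branch sets of clique minors\<close>

definition touch :: "('a \<Rightarrow> 'a \<Rightarrow> bool) \<Rightarrow> 'a set \<Rightarrow> 'a set \<Rightarrow> bool" where
  "touch adj A B \<longleftrightarrow> (\<exists>a\<in>A. \<exists>b\<in>B. adj a b)"

text \<open>Connectivity is expressed by cuts instead of paths, which suits images, preimages and
  unions.\<close>

definition connected_set :: "('a \<Rightarrow> 'a \<Rightarrow> bool) \<Rightarrow> 'a set \<Rightarrow> bool" where
  "connected_set adj A \<longleftrightarrow>
     A \<noteq> {} \<and> (\<forall>S. S \<subset> A \<and> S \<noteq> {} \<longrightarrow> touch adj S (A - S))"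

text \<open>A list allows explicit minors to be written down and checked by simplification.
  \<open>sorted_wrt\<close> covers every pair, in one order.\<close>

definition branch_sets :: "('a \<Rightarrow> 'a \<Rightarrow> bool) \<Rightarrow> 'a set list \<Rightarrow> bool" where
  "branch_sets adj Bs \<longleftrightarrow>
     (\<forall>B\<in>set Bs. connected_set adj B) \<and> sorted_wrt (\<lambda>A B. A \<inter> B = {} \<and> touch adj A B) Bs"

definition clique_minor :: "('a \<Rightarrow> 'a \<Rightarrow> bool) \<Rightarrow> 'a set \<Rightarrow> nat \<Rightarrow> bool" where
  "clique_minor adj X n \<longleftrightarrow> (\<exists>Bs. length Bs = n \<and> branch_sets adj Bs \<and> \<Union>(set Bs) \<subseteq> X)"

definition adjacent :: "'a sgraph \<Rightarrow> 'a \<Rightarrow> 'a \<Rightarrow> bool" where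
  "adjacent G x y \<longleftrightarrow> {x, y} \<in> edges G"

lemma symp_adjacent: "symp (adjacent G)"
  by (simp add: adjacent_def insert_commute symp_def)

lemma connected_setD:
  "connected_set adj A \<Longrightarrow> S \<subset> A \<Longrightarrow> S \<noteq> {} \<Longrightarrow> touch adj S (A - S)"
  by (simp add: connected_set_def)

lemma branch_sets_nth:
  assumes "branch_sets adj Bs" "symp adj"
    and "i < length Bs" "j < length Bs" "i \<noteq> j"
  shows "Bs ! i \<inter> Bs ! j = {}" "touch adj (Bs ! i) (Bs ! j)"
proof -
  have *: "Bs ! i \<inter> Bs ! j = {} \<and> touch adj (Bs ! i) (Bs ! j)" if "i < j" "j < length Bs" for i j
    using assms(1) that by (simp add: branch_sets_def sorted_wrt_iff_nth_less)
  show "Bs ! i \<inter> Bs ! j = {}" "touch adj (Bs ! i) (Bs ! j)"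
    using *[of i j] *[of j i] sympD[OF assms(2)] assms(3-) unfolding touch_def
    by (cases "i < j"; force)+
qed

lemma branch_sets_mono:
  assumes Bs: "branch_sets adj Bs" "\<Union>(set Bs) \<subseteq> X"
    and adj: "\<And>x y. x \<in> X \<Longrightarrow> y \<in> X \<Longrightarrow> adj x y \<Longrightarrow> adj' x y"
  shows "branch_sets adj' Bs"
proof -
  have touch: "touch adj' A B" if "touch adj A B" "A \<subseteq> X" "B \<subseteq> X" for A B
    using that adj unfolding touch_def by (meson subsetD)
  have "connected_set adj' B" if B: "B \<in> set Bs" for B
    unfolding connected_set_def
  proof (intro conjI allI impI)
    have B': "connected_set adj B" "B \<subseteq> X" using Bs B by (auto simp: branch_sets_def)
    then show "B \<noteq> {}" by (simp add: connected_set_def)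
    fix S assume S: "S \<subset> B \<and> S \<noteq> {}"
    then have "touch adj S (B - S)" using B'(1) by (simp add: connected_setD)
    then show "touch adj' S (B - S)" using S B'(2) by (intro touch) auto
  qed
  moreover have "sorted_wrt (\<lambda>A B. A \<inter> B = {} \<and> touch adj' A B) Bs"
  proof (rule sorted_wrt_mono_rel)
    show "sorted_wrt (\<lambda>A B. A \<inter> B = {} \<and> touch adj A B) Bs"
      using Bs(1) by (simp add: branch_sets_def)
    show "A \<inter> B = {} \<and> touch adj' A B"
      if "A \<in> set Bs" "B \<in> set Bs" "A \<inter> B = {} \<and> touch adj A B" for A B
      using that Bs(2) touch[of A B] by blast
  qed
  ultimately show ?thesis by (simp add: branch_sets_def)
qed

lemma clique_minor_mono:
  assumes "clique_minor adj X n" "X \<subseteq> Y"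
    and "\<And>x y. x \<in> X \<Longrightarrow> y \<in> X \<Longrightarrow> adj x y \<Longrightarrow> adj' x y"
  shows "clique_minor adj' Y n"
proof -
  obtain Bs where Bs: "length Bs = n" "branch_sets adj Bs" "\<Union>(set Bs) \<subseteq> X"
    using assms(1) by (auto simp: clique_minor_def)
  have "branch_sets adj' Bs" by (rule branch_sets_mono[OF Bs(2,3) assms(3)])
  then show ?thesis using Bs(1,3) assms(2) unfolding clique_minor_def by blast
qed

section \<open>Branch sets under edge contraction\<close>

definition merge :: "'a \<Rightarrow> 'a \<Rightarrow> 'a \<Rightarrow> 'a" where
  "merge v u = id(u := v)"

lemma merge_eqD: "merge v u a = merge v u b \<Longrightarrow> a = b \<or> {a, b} = {v, u}"
  by (auto simp: merge_def split: if_splits)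

lemma contract_eq_merge:
  "contract v u G = (merge v u ` verts G, (\<lambda>e. merge v u ` e) ` edges G - {{v}})"
  by (simp add: contract_def merge_def)

lemma edge_contractI:
  assumes "{a, b} \<in> edges G" "merge v u a \<noteq> merge v u b"
  shows "{merge v u a, merge v u b} \<in> edges (contract v u G)"
proof -
  have "{merge v u a, merge v u b} \<in> (\<lambda>e. merge v u ` e) ` edges G"
    using assms(1) by (intro image_eqI[of _ _ "{a, b}"]) simp_all
  moreover have "{merge v u a, merge v u b} \<noteq> {v}" using assms(2) by auto
  ultimately show ?thesis by (simp add: contract_eq_merge)
qed

lemma edge_contractE:
  assumes "simple_graph G" "{a', b'} \<in> edges (contract v u G)"
  obtains a b where "{a, b} \<in> edges G" "merge v u a = a'" "merge v u b = b'"
proof -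
  obtain e where e: "e \<in> edges G" "{a', b'} = merge v u ` e"
    using assms(2) by (auto simp: contract_eq_merge)
  obtain a b where ab: "e = {a, b}" using assms(1) e(1) by (rule simple_graph_edgeE)
  have "{a', b'} = {merge v u a, merge v u b}" using e ab by simp
  then consider "merge v u a = a'" "merge v u b = b'" | "merge v u b = a'" "merge v u a = b'"
    by (auto simp: doubleton_eq_iff)
  moreover have "{a, b} \<in> edges G" "{b, a} \<in> edges G" using e(1) ab by (simp_all add: insert_commute)
  ultimately show thesis using that by cases blast+
qed

lemma touch_contract_image:
  assumes "touch (adjacent G) A B" "merge v u ` A \<inter> merge v u ` B = {}"
  shows "touch (adjacent (contract v u G)) (merge v u ` A) (merge v u ` B)"
proof -
  obtain a b where ab: "a \<in> A" "b \<in> B" "{a, b} \<in> edges G"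
    using assms(1) by (auto simp: touch_def adjacent_def)
  then have "merge v u a \<noteq> merge v u b" using assms(2) by blast
  then have "{merge v u a, merge v u b} \<in> edges (contract v u G)" by (rule edge_contractI[OF ab(3)])
  then show ?thesis using ab(1,2) unfolding touch_def adjacent_def by blast
qed

text \<open>A cut of the image pulls back to a cut of \<open>A\<close>. An edge across the latter
  survives, since its ends have images on different sides.\<close>

lemma connected_set_contract_image:
  assumes "connected_set (adjacent G) A"
  shows "connected_set (adjacent (contract v u G)) (merge v u ` A)"
  unfolding connected_set_def
proof (intro conjI allI impI)
  show "merge v u ` A \<noteq> {}" using assms unfolding connected_set_def by blast
  fix S assume S: "S \<subset> merge v u ` A \<and> S \<noteq> {}"
  let ?S = "{a \<in> A. merge v u a \<in> S}"
  have im: "merge v u ` ?S = S" "merge v u ` (A - ?S) = merge v u ` A - S" using S by blast+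
  have "?S \<noteq> {}" "?S \<noteq> A" using S im(1) by blast+
  then have "touch (adjacent G) ?S (A - ?S)" by (intro connected_setD[OF assms]) auto
  moreover have "merge v u ` ?S \<inter> merge v u ` (A - ?S) = {}" unfolding im by blast
  ultimately show "touch (adjacent (contract v u G)) S (merge v u ` A - S)"
    using touch_contract_image[of G ?S "A - ?S" v u] unfolding im by blast
qed

text \<open>Both ends of the contracted pair lie in one branch set, so identifying them does not
  make two branch sets meet.\<close>

lemma branch_sets_contract_image:
  assumes Bs: "branch_sets (adjacent G) Bs" and k: "k < length Bs" "v \<in> Bs ! k" "u \<in> Bs ! k"
  shows "branch_sets (adjacent (contract v u G)) (map ((`) (merge v u)) Bs)"
  unfolding branch_sets_def sorted_wrt_iff_nth_less
proof (intro conjI ballI allI impI)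
  fix B assume "B \<in> set (map ((`) (merge v u)) Bs)"
  then have "B \<in> (`) (merge v u) ` set Bs" by simp
  then obtain B0 where B0: "B = merge v u ` B0" "B0 \<in> set Bs" by (rule imageE)
  then have "connected_set (adjacent G) B0" using Bs by (simp add: branch_sets_def)
  then show "connected_set (adjacent (contract v u G)) B"
    unfolding B0(1) by (rule connected_set_contract_image)
next
  fix i j assume ij: "i < j" "j < length (map ((`) (merge v u)) Bs)"
  note nth = branch_sets_nth[OF Bs symp_adjacent]
  have "merge v u a \<noteq> merge v u b" if "a \<in> Bs ! i" "b \<in> Bs ! j" for a b
  proof
    assume eq: "merge v u a = merge v u b"
    have "a \<noteq> b" using nth(1)[of i j] ij that by auto
    then have "{a, b} \<subseteq> Bs ! k" using merge_eqD[OF eq] k by auto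
    then have "Bs ! i \<inter> Bs ! k \<noteq> {}" "Bs ! j \<inter> Bs ! k \<noteq> {}" using that by auto
    then have "i = k" "j = k" using nth(1)[of i k] nth(1)[of j k] ij k(1) by auto
    then show False using ij by simp
  qed
  then have disj: "merge v u ` (Bs ! i) \<inter> merge v u ` (Bs ! j) = {}" by blast
  moreover have "touch (adjacent (contract v u G)) (merge v u ` (Bs ! i)) (merge v u ` (Bs ! j))"
    using ij nth(2)[of i j] by (intro touch_contract_image disj) simp
  ultimately show "map ((`) (merge v u)) Bs ! i \<inter> map ((`) (merge v u)) Bs ! j = {}"
    and "touch (adjacent (contract v u G)) (map ((`) (merge v u)) Bs ! i) (map ((`) (merge v u)) Bs ! j)"
    using ij by simp_all
qed

lemma graph_iso_complete_graph:
  assumes G: "simple_graph G" and Bs: "branch_sets (adjacent G) Bs" "\<Union>(set Bs) = verts G"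
    and single: "\<And>i. i < length Bs \<Longrightarrow> Bs ! i = {p i}"
  shows "graph_iso G (complete_graph (length Bs))"
proof -
  let ?r = "length Bs"
  note nth = branch_sets_nth[OF Bs(1) symp_adjacent]
  have inj: "inj_on p {..<?r}"
    using nth(1) single by (intro inj_onI) (metis Int_insert_right_if1 insertI1 insert_not_empty lessThan_iff)
  have "verts G = p ` {..<?r}"
  proof -
    have "set Bs = (\<lambda>i. {p i}) ` {..<?r}"
      unfolding set_conv_nth using single by force
    then show ?thesis unfolding Bs(2)[symmetric] by blast
  qed
  then have p: "bij_betw p {..<?r} (verts G)" using inj by (simp add: bij_betw_def)
  define \<phi> where "\<phi> = inv_into {..<?r} p"
  have \<phi>: "bij_betw \<phi> (verts G) {..<?r}" unfolding \<phi>_def by (rule bij_betw_inv_into[OF p])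
  have \<phi>p: "\<phi> (p i) = i" if "i < ?r" for i
    unfolding \<phi>_def using inj that by (simp add: inv_into_f_f)
  have adj: "{p i, p j} \<in> edges G" if "i < ?r" "j < ?r" "i \<noteq> j" for i j
    using nth(2)[OF that] single[OF that(1)] single[OF that(2)] by (simp add: touch_def adjacent_def)
  have "edges (complete_graph ?r) = (\<lambda>e. \<phi> ` e) ` edges G"
  proof (intro equalityI subsetI)
    fix e assume "e \<in> edges (complete_graph ?r)"
    then obtain i j where "e = {i, j}" "i < ?r" "j < ?r" "i \<noteq> j"
      by (auto simp: complete_graph_def)
    then have "e = \<phi> ` {p i, p j}" "{p i, p j} \<in> edges G" using \<phi>p adj by simp_all
    then show "e \<in> (\<lambda>e. \<phi> ` e) ` edges G" by blast
  next
    fix e assume "e \<in> (\<lambda>e. \<phi> ` e) ` edges G"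
    then obtain e' where e': "e' \<in> edges G" "e = \<phi> ` e'" by blast
    obtain a b where ab: "e' = {a, b}" "a \<noteq> b" "a \<in> verts G" "b \<in> verts G"
      using G e'(1) by (rule simple_graph_edgeE)
    then have "e = {\<phi> a, \<phi> b}" "\<phi> a \<noteq> \<phi> b" "\<phi> a < ?r" "\<phi> b < ?r"
      using e' \<phi> by (auto simp: bij_betw_def inj_on_def)
    then show "e \<in> edges (complete_graph ?r)" by (auto simp: complete_graph_def)
  qed
  then show ?thesis
    unfolding graph_iso_def using \<phi> by (intro exI[of _ \<phi>]) (simp add: complete_graph_def)
qed

text \<open>A branch set with several vertices is connected and thus contains an edge; contracting
  it preserves the branch sets and lowers the number of vertices. Once all branch sets are
  singletons, the graph is complete.\<close>

lemma contracts_to_complete_graph: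
  assumes "simple_graph G" "branch_sets (adjacent G) Bs" "\<Union>(set Bs) = verts G"
  shows "\<exists>T. contraction_step\<^sup>*\<^sup>* G T \<and> graph_iso T (complete_graph (length Bs))"
  using assms
proof (induction "card (verts G)" arbitrary: G Bs rule: less_induct)
  case less
  show ?case
  proof (cases "\<exists>k<length Bs. \<not> is_singleton (Bs ! k)")
    case False
    then have "Bs ! i = {the_elem (Bs ! i)}" if "i < length Bs" for i
      using that by (simp add: is_singleton_the_elem)
    then have "graph_iso G (complete_graph (length Bs))"
      using less.prems by (intro graph_iso_complete_graph) auto
    then show ?thesis by blast
  next
    case True
    then obtain k where k: "k < length Bs" "\<not> is_singleton (Bs ! k)" by blast
    have conn: "connected_set (adjacent G) (Bs ! k)"
      using less.prems(2) k(1) by (simp add: branch_sets_def)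
    then obtain v where v: "v \<in> Bs ! k" by (auto simp: connected_set_def)
    then have "{v} \<subset> Bs ! k" using k(2) by (auto simp: is_singleton_def)
    then obtain u where u: "u \<in> Bs ! k" "{v, u} \<in> edges G"
      using connected_setD[OF conn, of "{v}"] by (auto simp: touch_def adjacent_def)
    let ?G = "contract v u G"
    let ?Bs = "map ((`) (merge v u)) Bs"
    have "card (verts ?G) < card (verts G)"
      unfolding verts_contract[OF less.prems(1) u(2)]
      using simple_graph_edgeD[OF less.prems(1) u(2)] finite_verts[OF less.prems(1)]
      by (intro card_Diff1_less) auto
    moreover have "\<Union>(set ?Bs) = verts ?G"
      using less.prems(3) unfolding contract_eq_merge by auto
    ultimately obtain T where "contraction_step\<^sup>*\<^sup>* ?G T" "graph_iso T (complete_graph (length ?Bs))"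
      using less.hyps[of ?G ?Bs] simple_graph_contract[OF less.prems(1) u(2)]
        branch_sets_contract_image[OF less.prems(2) k(1) v u(1)] by blast
    moreover have "contraction_step G ?G" using u(2) by (auto simp: contraction_step_def)
    ultimately show ?thesis by (metis converse_rtranclp_into_rtranclp length_map)
  qed
qed

text \<open>The subgraph to contract is the one induced on the union of the branch sets, which then
  cover it.\<close>

lemma is_minor_if_clique_minor:
  assumes G: "simple_graph G" and K: "clique_minor (adjacent G) (verts G) r"
  shows "is_minor (complete_graph r) G"
proof -
  obtain Bs where Bs: "length Bs = r" "branch_sets (adjacent G) Bs" "\<Union>(set Bs) \<subseteq> verts G"
    using K by (auto simp: clique_minor_def)
  let ?S = "(\<Union>(set Bs), {e \<in> edges G. e \<subseteq> \<Union>(set Bs)})"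
  have S: "simple_graph ?S"
    unfolding simple_graph_def
  proof (intro conjI subsetI)
    show "finite (verts ?S)" using finite_subset[OF Bs(3) finite_verts[OF G]] by simp
    fix e assume e: "e \<in> edges ?S"
    then have "e \<in> edges G" by simp
    with G obtain a b where "e = {a, b}" "a \<noteq> b" by (rule simple_graph_edgeE)
    with e show "e \<in> {{u, v} |u v. u \<in> verts ?S \<and> v \<in> verts ?S \<and> u \<noteq> v}" by auto
  qed
  have "branch_sets (adjacent ?S) Bs"
    by (rule branch_sets_mono[OF Bs(2) order_refl]) (simp add: adjacent_def)
  then obtain T where "contraction_step\<^sup>*\<^sup>* ?S T" "graph_iso T (complete_graph r)"
    using contracts_to_complete_graph[OF S, of Bs] Bs(1) unfolding fst_conv by blast
  moreover have "subgraph ?S G" using S Bs(3) by (simp add: subgraph_def)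
  ultimately show ?thesis unfolding is_minor_def by blast
qed

text \<open>Branch sets are pulled back along \<open>merge v u\<close>. The only fibre with two
  points is \<open>{v, u}\<close>, and these are adjacent, so preimages of branch sets are
  connected.\<close>

lemma clique_minor_of_contract:
  assumes G: "simple_graph G" and vu: "{v, u} \<in> edges G"
    and K: "clique_minor (adjacent (contract v u G)) (verts (contract v u G)) r"
  shows "clique_minor (adjacent G) (verts G) r"
proof -
  obtain Bs where Bs: "length Bs = r" "branch_sets (adjacent (contract v u G)) Bs"
      "\<Union>(set Bs) \<subseteq> verts (contract v u G)"
    using K by (auto simp: clique_minor_def)
  let ?L = "\<lambda>B. {x \<in> verts G. merge v u x \<in> B}"
  have touch: "\<exists>a b. a \<in> ?L A \<and> b \<in> ?L B \<and> {a, b} \<in> edges G"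
    if AB: "touch (adjacent (contract v u G)) A B" for A B
  proof -
    obtain a' b' where ab': "a' \<in> A" "b' \<in> B" "{a', b'} \<in> edges (contract v u G)"
      using AB by (auto simp: touch_def adjacent_def)
    obtain a b where ab: "{a, b} \<in> edges G" "merge v u a = a'" "merge v u b = b'"
      using G ab'(3) by (rule edge_contractE)
    then show ?thesis using ab' simple_graph_edgeD[OF G ab(1)] by blast
  qed
  have "connected_set (adjacent G) (?L B)" if B: "B \<in> set Bs" for B
    unfolding connected_set_def
  proof (intro conjI allI impI)
    have conn: "connected_set (adjacent (contract v u G)) B"
      using Bs(2) B by (simp add: branch_sets_def)
    have "B \<subseteq> verts (contract v u G)" using Bs(3) B by (meson Sup_upper order_trans)
    then have surj: "B \<subseteq> merge v u ` verts G" by (simp add: contract_eq_merge)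
    obtain z where "z \<in> B" using conn by (auto simp: connected_set_def)
    with surj obtain x where "x \<in> verts G" "merge v u x \<in> B" by (metis imageE subsetD)
    then show "?L B \<noteq> {}" by blast
    fix S assume S: "S \<subset> ?L B \<and> S \<noteq> {}"
    show "touch (adjacent G) S (?L B - S)"
    \<comment> \<open>A cut that respects the fibres comes from a cut in the contraction; any other
      cut separates \<open>v\<close> from \<open>u\<close> and is crossed by their edge.\<close>
    proof (cases "\<forall>x\<in>S. \<forall>y\<in>?L B. merge v u x = merge v u y \<longrightarrow> y \<in> S")
      case True
      obtain y where y: "y \<in> ?L B" "y \<notin> S" using S by blast
      have "merge v u y \<notin> merge v u ` S"
      proof
        assume "merge v u y \<in> merge v u ` S"
        then obtain x where x: "merge v u y = merge v u x" "x \<in> S" by (rule imageE)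
        then show False using True[rule_format, OF x(2) y(1)] y(2) by simp
      qed
      moreover have "merge v u y \<in> B" using y(1) by simp
      moreover have "merge v u ` S \<subseteq> B" using S by auto
      ultimately have "merge v u ` S \<subset> B" by (metis psubsetI)
      moreover have "merge v u ` S \<noteq> {}" using S by simp
      ultimately have "touch (adjacent (contract v u G)) (merge v u ` S) (B - merge v u ` S)"
        using conn by (intro connected_setD)
      from touch[OF this] obtain a b where ab: "merge v u a \<in> merge v u ` S" "a \<in> verts G"
          "merge v u b \<in> B" "merge v u b \<notin> merge v u ` S" "b \<in> verts G" "{a, b} \<in> edges G"
        by blast
      from ab(1) obtain x where x: "merge v u a = merge v u x" "x \<in> S" by (rule imageE)
      have "merge v u x \<in> B" using x(2) S by blast
      then have "a \<in> ?L B" using ab(2) x(1) by simp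
      then have "a \<in> S" using True[rule_format, OF x(2) _ x(1)[symmetric]] by blast
      moreover have "b \<in> ?L B - S" using ab by blast
      ultimately show ?thesis using ab(6) unfolding touch_def adjacent_def by blast
    next
      case False
      then obtain x y where xy: "x \<in> S" "y \<in> ?L B - S" "merge v u x = merge v u y" by blast
      then have "x \<noteq> y" by blast
      then have "{x, y} \<in> edges G" using merge_eqD[OF xy(3)] vu by simp
      then show ?thesis using xy unfolding touch_def adjacent_def by blast
    qed
  qed
  moreover have "sorted_wrt (\<lambda>A B. A \<inter> B = {} \<and> touch (adjacent G) A B) (map ?L Bs)"
    unfolding sorted_wrt_map
  proof (rule sorted_wrt_mono_rel)
    show "sorted_wrt (\<lambda>A B. A \<inter> B = {} \<and> touch (adjacent (contract v u G)) A B) Bs"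
      using Bs(2) by (simp add: branch_sets_def)
    show "?L A \<inter> ?L B = {} \<and> touch (adjacent G) (?L A) (?L B)"
      if AB: "A \<inter> B = {} \<and> touch (adjacent (contract v u G)) A B" for A B
    proof
      show "?L A \<inter> ?L B = {}" using AB by blast
      show "touch (adjacent G) (?L A) (?L B)"
        using touch[of A B] AB unfolding touch_def adjacent_def by blast
    qed
  qed
  ultimately have "branch_sets (adjacent G) (map ?L Bs)" unfolding branch_sets_def by simp
  then show ?thesis
    unfolding clique_minor_def using Bs(1) by (intro exI[of _ "map ?L Bs"]) auto
qed

section \<open>Clique minors in small graphs of large minimum degree\<close>

locale adjacency =
  fixes adj :: "'a \<Rightarrow> 'a \<Rightarrow> bool"
  assumes sym: "adj x y \<Longrightarrow> adj y x" and irrefl: "\<not> adj x x"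
begin

lemma adj_commute: "adj x y \<longleftrightarrow> adj y x"
  using sym by blast

lemma touch_sym: "touch adj A B \<Longrightarrow> touch adj B A"
  unfolding touch_def using sym by blast

lemma touch_insert:
  "touch adj (insert a A) B \<longleftrightarrow> (\<exists>b\<in>B. adj a b) \<or> touch adj A B"
  "touch adj {} B \<longleftrightarrow> False"
  by (auto simp: touch_def)

lemma connected_set_singleton: "connected_set adj {x}"
  by (auto simp: connected_set_def)

lemma connected_set_Un:
  assumes A: "connected_set adj A" and B: "connected_set adj B" and AB: "touch adj A B"
  shows "connected_set adj (A \<union> B)"
  unfolding connected_set_def
proof (intro conjI allI impI)
  show "A \<union> B \<noteq> {}" using A by (simp add: connected_set_def)
  fix S assume S: "S \<subset> A \<union> B \<and> S \<noteq> {}"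
  consider "S \<inter> A \<noteq> {}" "S \<inter> A \<noteq> A" | "S \<inter> B \<noteq> {}" "S \<inter> B \<noteq> B"
    | "A \<subseteq> S" "S \<inter> B = {}" | "B \<subseteq> S" "S \<inter> A = {}"
    using S by blast
  then show "touch adj S (A \<union> B - S)"
  proof cases
    case 1
    then have "touch adj (S \<inter> A) (A - S \<inter> A)" by (intro connected_setD[OF A]) auto
    then show ?thesis unfolding touch_def by blast
  next
    case 2
    then have "touch adj (S \<inter> B) (B - S \<inter> B)" by (intro connected_setD[OF B]) auto
    then show ?thesis unfolding touch_def by blast
  next
    case 3
    then show ?thesis using AB unfolding touch_def by blast
  next
    case 4
    then show ?thesis using touch_sym[OF AB] unfolding touch_def by blast
  qed
qed

lemma connected_set_insert:
  assumes "connected_set adj A" "a \<in> A" "adj x a"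
  shows "connected_set adj (insert x A)"
proof -
  have "touch adj {x} A" using assms(2,3) by (auto simp: touch_def)
  from connected_set_Un[OF connected_set_singleton assms(1) this] show ?thesis by simp
qed

lemma connected_set_pair: "adj x y \<Longrightarrow> connected_set adj {x, y}"
  by (rule connected_set_insert[OF connected_set_singleton]) auto

lemma connected_set_subset_closed:
  assumes "connected_set adj D" "D \<inter> A \<noteq> {}"
    and "\<And>x y. x \<in> D \<inter> A \<Longrightarrow> y \<in> D \<Longrightarrow> adj x y \<Longrightarrow> y \<in> A"
  shows "D \<subseteq> A"
proof (rule ccontr)
  assume "\<not> D \<subseteq> A"
  then have "touch adj (D \<inter> A) (D - D \<inter> A)"
    using assms(2) by (intro connected_setD[OF assms(1)]) auto
  then show False using assms(3) unfolding touch_def by blast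
qed

lemma ex_component:
  assumes "finite W" "w \<in> W"
  obtains D where "w \<in> D" "D \<subseteq> W" "connected_set adj D"
    "\<And>x y. x \<in> D \<Longrightarrow> y \<in> W \<Longrightarrow> adj x y \<Longrightarrow> y \<in> D"
proof -
  let ?F = "{D. w \<in> D \<and> D \<subseteq> W \<and> connected_set adj D}"
  have "finite ?F" using assms(1) by (auto intro: finite_subset[of _ "Pow W"])
  moreover have "{w} \<in> ?F" using assms(2) connected_set_singleton by simp
  then have "?F \<noteq> {}" by blast
  ultimately have "\<exists>D\<in>?F. \<forall>D'\<in>?F. D \<le> D' \<longrightarrow> D = D'" by (rule finite_has_maximal)
  then obtain D where D: "D \<in> ?F" and max: "\<And>D'. D' \<in> ?F \<Longrightarrow> D \<subseteq> D' \<Longrightarrow> D = D'"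
    by (elim bexE) (rule that, assumption, blast)
  have "y \<in> D" if "x \<in> D" "y \<in> W" "adj x y" for x y
  proof -
    have "insert y D \<in> ?F"
      using D that connected_set_insert[of D x y] sym by simp
    then show ?thesis using max by blast
  qed
  then show thesis using D that by blast
qed

lemma clique_minor_cone:
  assumes "clique_minor adj N n" "\<And>x. x \<in> N \<Longrightarrow> adj v x" "N \<subseteq> X" "v \<in> X"
  shows "clique_minor adj X (Suc n)"
proof -
  obtain Bs where Bs: "length Bs = n" "branch_sets adj Bs" "\<Union>(set Bs) \<subseteq> N"
    using assms(1) by (auto simp: clique_minor_def)
  have "{v} \<inter> B = {} \<and> touch adj {v} B" if "B \<in> set Bs" for B
  proof -
    have "B \<subseteq> N" "B \<noteq> {}" using Bs that by (auto simp: branch_sets_def connected_set_def)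
    then show ?thesis using assms(2) irrefl unfolding touch_def by blast
  qed
  then have "branch_sets adj ({v} # Bs)"
    using Bs(2) connected_set_singleton by (simp add: branch_sets_def)
  then show ?thesis
    unfolding clique_minor_def using Bs assms(3,4) by (intro exI[of _ "{v} # Bs"]) auto
qed

lemma clique_minor_clique:
  assumes "pairwise adj Q" "n \<le> card Q" "Q \<subseteq> X"
  shows "clique_minor adj X n"
  using assms
proof (induction n arbitrary: Q X)
  case 0
  then show ?case unfolding clique_minor_def by (intro exI[of _ "[]"]) (simp add: branch_sets_def)
next
  case (Suc n)
  then obtain v where v: "v \<in> Q" by fastforce
  have "finite Q" using Suc.prems(2) card.infinite by fastforce
  then have "n \<le> card (Q - {v})" using Suc.prems(2) v by simp
  then have "clique_minor adj (Q - {v}) n"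
    using Suc.prems(1) by (intro Suc.IH) (auto intro: pairwise_subset)
  then show ?case
    by (rule clique_minor_cone[where v = v]) (use Suc.prems v in \<open>auto simp: pairwise_def\<close>)
qed

text \<open>Fewer than \<open>k\<close> vertices of \<open>M\<close> lie outside \<open>F\<close>,
  too few to hold all neighbours of \<open>x\<close>.\<close>

lemma ex_neighbour_in:
  assumes "finite M" "k \<le> card {y \<in> M. adj x y}" "F \<subseteq> M" "card M < card F + k"
  shows "\<exists>y\<in>F. adj x y"
proof (rule ccontr)
  assume "\<not> ?thesis"
  then have "{y \<in> M. adj x y} \<subseteq> M - F" by blast
  then have "k \<le> card (M - F)" using assms(1,2) by (meson card_mono finite_Diff order_trans)
  then show False
    using assms(1,3,4) card_mono[OF assms(1,3)] by (simp add: card_Diff_subset finite_subset)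
qed

lemma ex_neighbour_notin:
  assumes "finite F" "card F < card {y \<in> M. adj x y}"
  shows "\<exists>y\<in>M - F. adj x y"
proof (rule ccontr)
  assume "\<not> ?thesis"
  then have "{y \<in> M. adj x y} \<subseteq> F" by blast
  from card_mono[OF assms(1) this] show False using assms(2) by simp
qed

lemma all_neighbours:
  assumes "finite F" "{y \<in> M. adj x y} \<subseteq> F" "card F \<le> card {y \<in> M. adj x y}" "y \<in> F"
  shows "adj x y"
  using card_seteq[OF assms(1,2,3)] assms(4) by blast

lemmas branch_sets_explicit = branch_sets_def touch_insert connected_set_singleton connected_set_pair
  connected_set_insert

text \<open>A cycle suffices. The path \<open>c, a, b\<close> is prolonged at its ends by
  \<open>e\<close> and \<open>d\<close>; either a cycle with at most four vertices appears, or the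
  five vertices exhaust \<open>M\<close> and \<open>d\<close> and \<open>e\<close> must be
  adjacent.\<close>

lemma clique_minor_3_if_mindegree_2:
  assumes M: "finite M" "card M \<le> 5" "M \<noteq> {}"
    and deg: "\<And>x. x \<in> M \<Longrightarrow> 2 \<le> card {y \<in> M. adj x y}"
  shows "clique_minor adj M 3"
proof -
  have nbr: "\<exists>y\<in>M. y \<noteq> z \<and> adj x y" if "x \<in> M" for x z
    using ex_neighbour_notin[of "{z}" M x] deg[OF that] by auto
  have I: "clique_minor adj M 3"
    if "branch_sets adj [A, B, C]" "A \<union> B \<union> C \<subseteq> M" for A B C
    unfolding clique_minor_def using that by (intro exI[of _ "[A, B, C]"]) auto
  obtain a where a: "a \<in> M" using M(3) by blast
  obtain b where b: "b \<in> M" "adj a b" using nbr[OF a] by blast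
  obtain c where c: "c \<in> M" "c \<noteq> b" "adj a c" using nbr[OF a, of b] by blast
  obtain d where d: "d \<in> M" "d \<noteq> a" "adj b d" using nbr[OF b(1), of a] by blast
  obtain e where e: "e \<in> M" "e \<noteq> a" "adj c e" using nbr[OF c(1), of a] by blast
  have ne: "a \<noteq> b" "a \<noteq> c" "b \<noteq> d" "c \<noteq> e" using b c d e irrefl by auto
  \<comment> \<open>This is the 4-cycle \<open>a, y, x, z\<close>.\<close>
  have star: "clique_minor adj M 3"
    if "x \<in> M" "adj a y" "adj a z" "adj y x" "adj z x" "x \<noteq> a" "y \<noteq> z" "y \<in> M" "z \<in> M" for x y z
  proof (rule I[of "{a}" "{y}" "{z, x}"])
    have "x \<noteq> y" "x \<noteq> z" "a \<noteq> y" "a \<noteq> z" using that irrefl by auto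
    then show "branch_sets adj [{a}, {y}, {z, x}]" using that by (auto simp: branch_sets_explicit)
  qed (use that a in auto)
  show ?thesis
  proof (cases "adj b c")
    case True
    then show ?thesis
      using a b c ne by (intro I[of "{a}" "{b}" "{c}"]) (auto simp: branch_sets_explicit)
  next
    case bc: False
    then have ne2: "d \<noteq> c" "e \<noteq> b" using d e sym by auto
    show ?thesis
    proof (cases "d = e \<or> adj d c \<or> adj e b \<or> adj d a")
      case True
      then show ?thesis
        using star[of d b c] star[of e b c] a b c d e ne ne2 bc
          I[of "{a}" "{b}" "{d}"] by (auto simp: branch_sets_explicit adj_commute)
    next
      case False
      then have "card {a, b, c, d, e} = 5" using ne ne2 c d e by auto
      then have "M = {a, b, c, d, e}"
        using card_seteq[OF M(1), of "{a, b, c, d, e}"] M(2) a b c d e by auto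
      moreover obtain y where "y \<in> M" "y \<noteq> b" "adj d y" using nbr[OF d(1), of b] by blast
      ultimately have "adj d e" using False irrefl by auto
      then have "connected_set adj {d, e, c}"
        using e sym by (intro connected_set_insert[OF connected_set_pair]) auto
      then show ?thesis
        using a b c d e ne ne2 False by (intro I[of "{a}" "{b}" "{d, e, c}"]) (auto simp: branch_sets_explicit)
    qed
  qed
qed

text \<open>Two nonadjacent vertices \<open>p\<close>, \<open>q\<close> must be adjacent to all
  others, of which there are exactly three. An edge \<open>{x, y}\<close> among these yields the
  branch sets \<open>{p}\<close>, \<open>{x}\<close>, \<open>{y}\<close>, \<open>{q, z}\<close>; it
  exists because three neighbours of \<open>a\<close> do not fit into \<open>{p, q}\<close>.\<close>

lemma clique_minor_4_if_mindegree_3: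
  assumes N: "finite N" "card N \<le> 5" "N \<noteq> {}"
    and deg: "\<And>x. x \<in> N \<Longrightarrow> 3 \<le> card {y \<in> N. adj x y}"
  shows "clique_minor adj N 4"
proof (cases "pairwise adj N")
  case True
  obtain x where x: "x \<in> N" using N(3) by blast
  have "card {y \<in> N. adj x y} < card N"
    using N(1) x irrefl by (intro psubset_card_mono) auto
  then show ?thesis using deg[OF x] True by (intro clique_minor_clique[of N]) auto
next
  case False
  then obtain p q where pq: "p \<in> N" "q \<in> N" "p \<noteq> q" "\<not> adj p q" by (auto simp: pairwise_def)
  let ?M = "N - {p, q}"
  have cM: "card ?M \<le> 3" using N(1,2) pq by (simp add: card_Diff_subset)
  have p: "adj p x" and q: "adj q x" if "x \<in> ?M" for x
  proof -
    have sub: "{y \<in> N. adj p y} \<subseteq> ?M" "{y \<in> N. adj q y} \<subseteq> ?M"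
      using pq irrefl sym by blast+
    have card: "card ?M \<le> card {y \<in> N. adj p y}" "card ?M \<le> card {y \<in> N. adj q y}"
      using cM deg[OF pq(1)] deg[OF pq(2)] by linarith+
    show "adj p x" "adj q x"
      using all_neighbours[OF _ sub(1) card(1) that] all_neighbours[OF _ sub(2) card(2) that] N(1)
      by (blast intro: finite_Diff)+
  qed
  have "{y \<in> N. adj p y} \<subseteq> ?M" using pq irrefl by blast
  then have "card ?M = 3"
    using cM deg[OF pq(1)] card_mono[of ?M "{y \<in> N. adj p y}"] N(1) by simp
  then obtain a b c where abc: "?M = {a, b, c}" "a \<noteq> b" "a \<noteq> c" "b \<noteq> c" by (auto simp: card_3_iff)
  have I: "clique_minor adj N 4" if "adj x y" "{x, y, z} = {a, b, c}" "z \<noteq> x" "z \<noteq> y" for x y z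
  proof -
    have xyz: "x \<in> ?M" "y \<in> ?M" "z \<in> ?M" using that(2) unfolding abc(1) by auto
    have "branch_sets adj [{p}, {x}, {y}, {q, z}]"
      using p[OF xyz(1)] p[OF xyz(2)] p[OF xyz(3)] q[OF xyz(1)] q[OF xyz(2)] q[OF xyz(3)]
        xyz that pq irrefl by (auto simp: branch_sets_explicit adj_commute)
    then show ?thesis
      unfolding clique_minor_def using xyz pq by (intro exI[of _ "[{p}, {x}, {y}, {q, z}]"]) auto
  qed
  have "a \<in> N" using abc(1) by blast
  have "card N = 5" using N(1) pq \<open>card ?M = 3\<close> by (simp add: card_Diff_subset)
  then have "\<exists>y\<in>{a, b, c}. adj a y"
    using abc N(1) deg[OF \<open>a \<in> N\<close>] by (intro ex_neighbour_in[of N 3]) auto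
  then have "adj a b \<or> adj a c" using irrefl by blast
  then show ?thesis using I[of a b c] I[of a c b] abc by auto
qed


text \<open>Every vertex of the clique has a neighbour in the rest \<open>R\<close>, so a connected
  \<open>R\<close> is a fifth branch set. A disconnected \<open>R\<close> has at most three vertices
  and hence an isolated one, whose four neighbours must be all of \<open>Q\<close>.\<close>

lemma clique_minor_5_if_K4:
  assumes N: "finite N" "card N \<le> 7"
    and deg: "\<And>x. x \<in> N \<Longrightarrow> 4 \<le> card {y \<in> N. adj x y}"
    and Q: "Q \<subseteq> N" "card Q = 4" "pairwise adj Q"
  shows "clique_minor adj N 5"
proof -
  obtain a b c d where abcd: "Q = {a, b, c, d}" "distinct [a, b, c, d]"
    using Q(2) by (auto simp: card_Suc_eq numeral_eq_Suc)
  have Q': "x \<in> N" "finite Q" if "x \<in> Q" for x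
    using that Q(1) N(1) finite_subset by auto
  define R where "R = N - Q"
  have R: "finite R" "card R \<le> 3"
    using N Q(1,2) Q' by (auto simp: R_def card_Diff_subset finite_subset)
  have "\<exists>y\<in>R. adj x y" if x: "x \<in> Q" for x
  proof -
    have "card (Q - {x}) = 3" using Q(2) x Q'(2)[OF x] by simp
    then have "\<exists>y\<in>N - (Q - {x}). adj x y"
      using deg[OF Q'(1)[OF x]] Q'(2)[OF x] by (intro ex_neighbour_notin) auto
    then show ?thesis using irrefl unfolding R_def by blast
  qed
  then have nbr: "touch adj {x} R" if "x \<in> Q" for x using that by (simp add: touch_def)
  show ?thesis
  proof (cases "connected_set adj R")
    case True
    have "branch_sets adj [{a}, {b}, {c}, {d}, R]"
      using abcd Q(3) nbr True connected_set_singleton unfolding R_def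
      by (simp add: branch_sets_def pairwise_insert) (auto simp: touch_def)
    then show ?thesis
      unfolding clique_minor_def using Q(1) abcd
      by (intro exI[of _ "[{a}, {b}, {c}, {d}, R]"]) (auto simp: R_def)
  next
    case False
    have "R \<noteq> {}" using nbr[of a] abcd(1) by (auto simp: touch_def)
    then obtain S where S: "S \<subset> R" "S \<noteq> {}" "\<not> touch adj S (R - S)"
      using False by (auto simp: connected_set_def)
    have "\<exists>r\<in>R. \<forall>y\<in>R. \<not> adj r y"
    proof -
      have "finite S" using S(1) R(1) finite_subset by blast
      then have "card S + card (R - S) \<le> 3"
        using R S(1) card_mono[of R S] by (simp add: card_Diff_subset psubset_imp_subset)
      moreover have "card (R - S) > 0" "card S > 0"
        using S R(1) \<open>finite S\<close> by (auto simp: card_gt_0_iff)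
      ultimately consider "card S = 1" | "card (R - S) = 1" by linarith
      then show ?thesis
      proof cases
        case 1
        then obtain r where "S = {r}" by (rule card_1_singletonE)
        then show ?thesis using S(1,3) irrefl by (intro bexI[of _ r]) (auto simp: touch_def)
      next
        case 2
        then obtain r where r: "R - S = {r}" by (rule card_1_singletonE)
        then have "r \<in> R" by blast
        have "\<not> adj r y" if "y \<in> R" for y
        proof (cases "y = r")
          case False
          then have "y \<in> S" using that r by blast
          then show ?thesis using S(3) r sym[of r y] by (auto simp: touch_def)
        qed (simp add: irrefl)
        then show ?thesis using \<open>r \<in> R\<close> by blast
      qed
    qed
    then obtain r where r: "r \<in> R" "\<And>y. y \<in> R \<Longrightarrow> \<not> adj r y" by blast
    have "adj r x" if "x \<in> Q" for x
    proof (rule all_neighbours[where F = Q and M = N])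
      show "{y \<in> N. adj r y} \<subseteq> Q" using r unfolding R_def by blast
      show "card Q \<le> card {y \<in> N. adj r y}" using deg[of r] r Q(2) by (simp add: R_def)
    qed (use that Q' in auto)
    then show ?thesis
      using clique_minor_cone[OF clique_minor_clique[OF Q(3), of 4 Q], of r N] Q r by (simp add: R_def)
  qed
qed

text \<open>By the lemma on four-vertex cliques, three common neighbours form an independent set
  \<open>T\<close>. Each needs four neighbours among \<open>a\<close>, \<open>b\<close> and at most
  two remaining vertices, so there are two such vertices \<open>f\<close>, \<open>g\<close>, both
  joined to all of \<open>T\<close>.\<close>

lemma clique_minor_5_if_edge_in_3_triangles:
  assumes N: "finite N" "card N \<le> 7"
    and deg: "\<And>x. x \<in> N \<Longrightarrow> 4 \<le> card {y \<in> N. adj x y}"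
    and ab: "a \<in> N" "b \<in> N" "adj a b" and C: "3 \<le> card {x \<in> N. adj a x \<and> adj b x}"
  shows "clique_minor adj N 5"
proof (rule ccontr)
  assume no: "\<not> clique_minor adj N 5"
  obtain T where T: "T \<subseteq> {x \<in> N. adj a x \<and> adj b x}" "card T = 3"
    using obtain_subset_with_card_n[OF C] by metis
  then obtain c d e where cde: "T = {c, d, e}" "c \<noteq> d" "c \<noteq> e" "d \<noteq> e" by (auto simp: card_3_iff)
  have ab': "a \<noteq> b" using ab(3) irrefl by blast
  have ne: "a \<notin> T" "b \<notin> T" using T(1) irrefl by auto
  have ind: "\<not> adj x y" if "x \<in> T" "y \<in> T" for x y
  proof
    assume xy: "adj x y"
    then have "x \<noteq> y" using irrefl by blast
    have xy': "x \<in> N" "y \<in> N" "adj a x" "adj a y" "adj b x" "adj b y"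
      using T(1) that by blast+
    have ne': "a \<noteq> x" "a \<noteq> y" "b \<noteq> x" "b \<noteq> y" using that ne by blast+
    have "card {a, b, x, y} = 4" using \<open>x \<noteq> y\<close> ab' ne' by simp
    moreover have "pairwise adj {a, b, x, y}"
      using ab(3) xy xy'(3-6) by (auto simp: pairwise_insert intro: sym)
    moreover have "{a, b, x, y} \<subseteq> N" using ab xy' by simp
    ultimately show False using clique_minor_5_if_K4[OF N deg] no by blast
  qed
  define R where "R = N - ({a, b} \<union> T)"
  have "{a, b} \<union> T \<subseteq> N" "card ({a, b} \<union> T) = 5" using ab ab' ne T cde by auto
  then have R: "finite R" "card R \<le> 2"
    using N by (auto simp: R_def card_Diff_subset finite_subset)
  have sub: "{y \<in> N. adj x y} \<subseteq> {a, b} \<union> R" if "x \<in> T" for x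
    using ind[OF that] unfolding R_def by blast
  have "card ({a, b} \<union> R) = 2 + card R"
    using ab' R(1) by (subst card_Un_disjoint) (auto simp: R_def)
  moreover have "4 \<le> card ({a, b} \<union> R)"
  proof -
    have c: "c \<in> T" "c \<in> N" using T(1) cde(1) by auto
    have "card {y \<in> N. adj c y} \<le> card ({a, b} \<union> R)"
      using R(1) by (intro card_mono sub c) simp
    then show ?thesis using deg[OF c(2)] by linarith
  qed
  ultimately have cR: "card R = 2" "card ({a, b} \<union> R) = 4" using R(2) by simp_all
  have TR: "adj x y" if "x \<in> T" "y \<in> R" for x y
  proof (rule all_neighbours[OF _ sub])
    have "x \<in> N" using that(1) T(1) by blast
    then show "card ({a, b} \<union> R) \<le> card {y \<in> N. adj x y}" using deg cR(2) by simp
  qed (use that R(1) in auto)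
  obtain f g where fg: "R = {f, g}" "f \<noteq> g" using cR(1) by (auto simp: card_2_iff)
  have T': "adj a x" "adj b x" "x \<in> N" if "x \<in> T" for x using T(1) that by auto
  have fg': "f \<notin> {a, b} \<union> T" "g \<notin> {a, b} \<union> T" "f \<in> N" "g \<in> N" using fg unfolding R_def by auto
  have c: "c \<in> T" "d \<in> T" "e \<in> T" "f \<in> R" "g \<in> R" using cde fg by auto
  have "branch_sets adj [{a}, {b}, {c}, {d, f}, {e, g}]"
    using ab ab' ne fg fg' cde T'[OF c(1)] T'[OF c(2)] T'[OF c(3)]
      TR[OF c(1,4)] TR[OF c(2,4)] TR[OF c(3,4)] TR[OF c(1,5)] TR[OF c(2,5)] TR[OF c(3,5)]
    by (auto simp: branch_sets_explicit)
  then have "clique_minor adj N 5"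
    unfolding clique_minor_def using ab T' fg' c
    by (intro exI[of _ "[{a}, {b}, {c}, {d, f}, {e, g}]"]) auto
  then show False using no by blast
qed


text \<open>Together with \<open>{p}\<close> and \<open>{q}\<close> the branch sets would form a
  clique minor on \<open>n + 2\<close> sets as soon as an edge \<open>{p, q}\<close> is
  added.\<close>

definition double_cone_minor :: "'a \<Rightarrow> 'a \<Rightarrow> 'a set \<Rightarrow> nat \<Rightarrow> bool" where
  "double_cone_minor p q N n \<longleftrightarrow>
     (\<exists>Bs. length Bs = n \<and> branch_sets adj Bs \<and> \<Union>(set Bs) \<subseteq> N - {p, q} \<and>
       (\<forall>B\<in>set Bs. touch adj {p} B \<and> touch adj {q} B))"

lemma double_cone_minor_commute: "double_cone_minor p q N n \<longleftrightarrow> double_cone_minor q p N n"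
  by (auto simp: double_cone_minor_def insert_commute)

lemma double_cone_minorI:
  assumes "branch_sets adj [A, B, C]" "A \<union> B \<union> C \<subseteq> N - {p, q}"
    and "touch adj {p} A" "touch adj {p} B" "touch adj {p} C"
    and "touch adj {q} A" "touch adj {q} B" "touch adj {q} C"
  shows "double_cone_minor p q N 3"
  unfolding double_cone_minor_def using assms by (intro exI[of _ "[A, B, C]"]) auto

section \<open>Double cones in links with exactly seven vertices\<close>

context
  fixes N p q
  assumes N: "finite N" "card N = 7"
    and deg: "\<And>x. x \<in> N \<Longrightarrow> 4 \<le> card {y \<in> N. adj x y}"
    and pq: "p \<in> N" "q \<in> N" "p \<noteq> q" "\<not> adj p q"
begin

lemma neighbour_in_4: "x \<in> N \<Longrightarrow> F \<subseteq> N \<Longrightarrow> card F = 4 \<Longrightarrow> \<exists>y\<in>F. adj x y"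
  using ex_neighbour_in[OF N(1) deg] N(2) by simp

text \<open>Apart from \<open>p\<close>, the vertex \<open>s\<close> misses at most one vertex
  \<open>a\<close>. It is absorbed into a branch set \<open>{z, s}\<close> in which \<open>z\<close>
  makes contact with \<open>p\<close> and \<open>q\<close>. If the other three vertices
  \<open>b\<close>, \<open>c\<close>, \<open>d\<close> of \<open>M'\<close> span no edge, the
  degrees force \<open>b\<close> and \<open>c\<close> to be adjacent to \<open>a\<close>.\<close>

lemma double_cone_minor_if_one_missing:
  assumes M: "N - {p, q} = insert s M'" "s \<notin> M'" "card M' = 4"
    and ps: "\<not> adj p s" and p: "\<And>x. x \<in> M' \<Longrightarrow> adj p x" and q: "\<And>x. x \<in> M' \<Longrightarrow> adj q x"
  shows "double_cone_minor p q N 3"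
proof -
  have inN: "s \<in> N" "M' \<subseteq> N" "s \<noteq> p" "s \<noteq> q" "p \<notin> M'" "q \<notin> M'" using M(1) by blast+
  have fin: "finite M'" using inN(2) N(1) finite_subset by blast
  \<comment> \<open>One of \<open>s, p, x, y\<close> is a neighbour of \<open>s\<close>, and it is
    neither \<open>s\<close> nor \<open>p\<close>.\<close>
  have s: "adj s x \<or> adj s y" if "x \<in> M'" "y \<in> M'" "x \<noteq> y" for x y
  proof -
    have "x \<noteq> s" "y \<noteq> s" "x \<noteq> p" "y \<noteq> p" using that M(2) inN by blast+
    then have "card {s, p, x, y} = 4" using that(3) inN(3) by simp
    moreover have "{s, p, x, y} \<subseteq> N" using that inN pq by auto
    ultimately obtain z where "z \<in> {s, p, x, y}" "adj s z" using neighbour_in_4 inN(1) by blast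
    then show ?thesis using irrefl ps sym by blast
  qed
  have I: "double_cone_minor p q N 3"
    if "x \<in> M'" "y \<in> M'" "z \<in> M'" "x \<noteq> y" "x \<noteq> z" "y \<noteq> z" "adj s z" "adj x y"
       "adj s x \<or> adj z x" "adj s y \<or> adj z y" for x y z
  proof (rule double_cone_minorI[of "{x}" "{y}" "{z, s}"])
    have "x \<noteq> s" "y \<noteq> s" using that M(2) by blast+
    then show "branch_sets adj [{x}, {y}, {z, s}]" using that by (auto simp: branch_sets_explicit adj_commute)
    show "{x} \<union> {y} \<union> {z, s} \<subseteq> N - {p, q}" unfolding M(1) using that by blast
  qed (use that p q in \<open>auto simp: touch_def\<close>)
  have "\<exists>a\<in>M'. \<forall>x\<in>M' - {a}. adj s x"
  proof (cases "\<forall>x\<in>M'. adj s x")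
    case True
    moreover have "M' \<noteq> {}" using M(3) by auto
    ultimately show ?thesis by blast
  qed (use s in blast)
  then obtain a where a: "a \<in> M'" "\<And>x. x \<in> M' - {a} \<Longrightarrow> adj s x" by blast
  have "card (M' - {a}) = 3" using M(3) a(1) fin by simp
  then obtain b c d where bcd: "M' - {a} = {b, c, d}" "b \<noteq> c" "b \<noteq> d" "c \<noteq> d"
    by (auto simp: card_3_iff)
  have in': "b \<in> M' - {a}" "c \<in> M' - {a}" "d \<in> M' - {a}" using bcd(1) by blast+
  then have mem: "b \<in> M'" "c \<in> M'" "d \<in> M'" "a \<noteq> b" "a \<noteq> c" "a \<noteq> d" by auto
  note sa = a(2)[OF in'(1)] a(2)[OF in'(2)] a(2)[OF in'(3)]
  show ?thesis
  proof (cases "adj b c \<or> adj b d \<or> adj c d")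
    case True
    then consider "adj b c" | "adj b d" | "adj c d" by blast
    then show ?thesis
    proof cases
      case 1
      show ?thesis by (rule I[of b c d]) (use mem bcd(2-4) sa 1 in auto)
    next
      case 2
      show ?thesis by (rule I[of b d c]) (use mem bcd(2-4) sa 2 in auto)
    next
      case 3
      show ?thesis by (rule I[of c d b]) (use mem bcd(2-4) sa 3 in auto)
    qed
  next
    case False
    have "card {a, b, c, d} = 4" using mem bcd(2-4) by simp
    moreover have "{a, b, c, d} \<subseteq> N" "b \<in> N" "c \<in> N" using mem a(1) inN(2) by auto
    ultimately have "\<exists>y\<in>{a, b, c, d}. adj b y" "\<exists>y\<in>{a, b, c, d}. adj c y"
      using neighbour_in_4 by blast+
    then have "adj b a" "adj c a" using False irrefl sym by blast+
    then show ?thesis by (intro I[of b a c]) (use mem bcd(2-4) a(1) sa sym in auto)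
  qed
qed

text \<open>In the branch sets \<open>{s, x}\<close>, \<open>{t, y}\<close>, \<open>{z}\<close> the
  vertices \<open>x\<close> and \<open>y\<close> make the contacts with \<open>p\<close> and
  \<open>q\<close> that \<open>s\<close> and \<open>t\<close> lack. Each of \<open>s\<close> and
  \<open>t\<close> misses at most one further vertex, and the position of that vertex determines the
  choice of \<open>x\<close>, \<open>y\<close>, \<open>z\<close>.\<close>

lemma double_cone_minor_if_two_missing:
  assumes M: "N - {p, q} = {s, t, a, b, c}" "distinct [s, t, a, b, c]"
    and ps: "\<not> adj p s" and qt: "\<not> adj q t"
    and p: "\<And>x. x \<in> {t, a, b, c} \<Longrightarrow> adj p x" and q: "\<And>x. x \<in> {s, a, b, c} \<Longrightarrow> adj q x"
  shows "double_cone_minor p q N 3"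
proof -
  have inN: "{s, t, a, b, c} \<subseteq> N" "p \<notin> {s, t, a, b, c}" "q \<notin> {s, t, a, b, c}"
    unfolding M(1)[symmetric] by auto
  have s: "adj s x \<or> adj s y" if "x \<in> {t, a, b, c}" "y \<in> {t, a, b, c}" "x \<noteq> y" for x y
  proof -
    have "x \<noteq> s" "y \<noteq> s" "x \<noteq> p" "y \<noteq> p" "s \<noteq> p" using that M(2) inN by auto
    then have "card {s, p, x, y} = 4" using that(3) by simp
    moreover have "{s, p, x, y} \<subseteq> N" "s \<in> N" using inN pq that by auto
    ultimately obtain z where "z \<in> {s, p, x, y}" "adj s z" using neighbour_in_4 by blast
    then show ?thesis using irrefl ps sym by blast
  qed
  have t: "adj t x \<or> adj t y" if "x \<in> {s, a, b, c}" "y \<in> {s, a, b, c}" "x \<noteq> y" for x y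
  proof -
    have "x \<noteq> t" "y \<noteq> t" "x \<noteq> q" "y \<noteq> q" "t \<noteq> q" using that M(2) inN by auto
    then have "card {t, q, x, y} = 4" using that(3) by simp
    moreover have "{t, q, x, y} \<subseteq> N" "t \<in> N" using inN pq that by auto
    ultimately obtain z where "z \<in> {t, q, x, y}" "adj t z" using neighbour_in_4 by blast
    then show ?thesis using irrefl qt sym by blast
  qed
  have I: "double_cone_minor p q N 3"
    if xyz: "{x, y, z} = {a, b, c}" "x \<noteq> y" "x \<noteq> z" "y \<noteq> z"
      and "adj s x" "adj t y" "adj s t \<or> adj s y" "adj s z \<or> adj x z" "adj t z \<or> adj y z" for x y z
  proof (rule double_cone_minorI[of "{s, x}" "{t, y}" "{z}"])
    have in': "x \<in> {a, b, c}" "y \<in> {a, b, c}" "z \<in> {a, b, c}" unfolding xyz(1)[symmetric] by simp_all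
    have "x \<noteq> s" "y \<noteq> s" "z \<noteq> s" "x \<noteq> t" "y \<noteq> t" "z \<noteq> t" "s \<noteq> t" using in' M(2) by auto
    then show "branch_sets adj [{s, x}, {t, y}, {z}]" using that by (auto simp: branch_sets_explicit adj_commute)
    show "{s, x} \<union> {t, y} \<union> {z} \<subseteq> N - {p, q}" unfolding M(1) using in' by blast
    have "adj p x" "adj p t" "adj p z" "adj q s" "adj q y" "adj q z" using in' by (auto intro: p q)
    then show "touch adj {p} {s, x}" "touch adj {p} {t, y}" "touch adj {p} {z}"
      "touch adj {q} {s, x}" "touch adj {q} {t, y}" "touch adj {q} {z}" by (auto simp: touch_def)
  qed
  have abc: "a \<noteq> b" "a \<noteq> c" "b \<noteq> c" "a \<noteq> t" "b \<noteq> t" "c \<noteq> t" "a \<noteq> s" "b \<noteq> s" "c \<noteq> s"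
    using M(2) by auto
  have others: "\<exists>x y. {x, y, m} = {a, b, c} \<and> x \<noteq> y \<and> x \<noteq> m \<and> y \<noteq> m" if "m \<in> {a, b, c}" for m
  proof -
    consider "m = a" | "m = b" | "m = c" using \<open>m \<in> {a, b, c}\<close> by blast
    then show ?thesis
    proof cases
      case 1 then show ?thesis using abc by (intro exI[of _ b] exI[of _ c]) auto
    next
      case 2 then show ?thesis using abc by (intro exI[of _ a] exI[of _ c]) auto
    next
      case 3 then show ?thesis using abc by (intro exI[of _ a] exI[of _ b]) auto
    qed
  qed
  consider (both) m where "m \<in> {a, b, c}" "\<not> adj s m" "\<not> adj t m"
    | (only_t) m where "m \<in> {a, b, c}" "\<not> adj t m" "adj s m"
    | (only_s) m where "m \<in> {a, b, c}" "\<not> adj s m" "\<And>x. x \<in> {a, b, c} \<Longrightarrow> adj t x"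
    | (none) "\<And>x. x \<in> {a, b, c} \<Longrightarrow> adj s x" "\<And>x. x \<in> {a, b, c} \<Longrightarrow> adj t x"
    by blast
  then show ?thesis
  proof cases
    case both
    obtain x y where xy: "{x, y, m} = {a, b, c}" "x \<noteq> y" "x \<noteq> m" "y \<noteq> m"
      using others[OF both(1)] by blast
    have in': "x \<in> {a, b, c}" "y \<in> {a, b, c}" unfolding xy(1)[symmetric] by simp_all
    have ne: "m \<noteq> t" "m \<noteq> s" "x \<noteq> s" "x \<noteq> t" "y \<noteq> s" "y \<noteq> t" "s \<noteq> t"
      using both(1) in' M(2) by auto
    have st: "adj s t" using s[of t m] both ne by auto
    have sx: "adj s x" using s[of x m] both in' xy by auto
    have ty: "adj t y" using t[of y m] both in' xy by auto
    \<comment> \<open>\<open>m\<close> already misses itself, \<open>s\<close> and \<open>t\<close>;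
      having four neighbours among seven vertices, it is adjacent to everything else.\<close>
    have "adj m z" if "z \<in> {x, y}" for z
    proof -
      have "card {m, s, t, z} = 4" using that ne xy by auto
      moreover have "{m, s, t, z} \<subseteq> N" "m \<in> N" using inN that both(1) in' by auto
      ultimately obtain w where "w \<in> {m, s, t, z}" "adj m w" using neighbour_in_4 by blast
      then show ?thesis using irrefl both sym by blast
    qed
    then show ?thesis using I[OF xy sx ty] st sym by blast
  next
    case only_t
    obtain x y where xy: "{x, y, m} = {a, b, c}" "x \<noteq> y" "x \<noteq> m" "y \<noteq> m"
      using others[OF only_t(1)] by blast
    have in': "x \<in> {a, b, c}" "y \<in> {a, b, c}" unfolding xy(1)[symmetric] by simp_all
    have ne: "m \<noteq> t" "m \<noteq> s" "s \<noteq> t" using only_t(1) M(2) by auto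
    have ts: "adj s t" using t[of s m] only_t(1,2) ne sym by auto
    have txy: "adj t x" "adj t y" using t[of x m] t[of y m] only_t(1,2) in' xy by auto
    have "adj s x \<or> adj s y" using s[of x y] in' xy(2) by auto
    moreover have "{m, y, x} = {a, b, c}" "{m, x, y} = {a, b, c}" using xy(1) by auto
    ultimately show ?thesis
      using I[of m y x] I[of m x y] xy(2-4) only_t(3) txy ts by metis
  next
    case only_s
    obtain x y where xy: "{x, y, m} = {a, b, c}" "x \<noteq> y" "x \<noteq> m" "y \<noteq> m"
      using others[OF only_s(1)] by blast
    have in': "x \<in> {a, b, c}" "y \<in> {a, b, c}" unfolding xy(1)[symmetric] by simp_all
    have ne: "m \<noteq> t" "m \<noteq> s" "s \<noteq> t" using only_s(1) M(2) by auto
    have st: "adj s t" "adj s x" "adj s y" using s[of t m] s[of x m] s[of y m] only_s(1,2) in' xy ne by auto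
    moreover have "{x, m, y} = {a, b, c}" using xy(1) by auto
    ultimately show ?thesis using I[of x m y] xy(2-4) only_s(1,3) in' by metis
  next
    case none
    then show ?thesis using I[of a b c] abc by simp
  qed
qed

end

text \<open>If \<open>p\<close> and \<open>q\<close> see all other vertices, these are at most five,
  of minimum degree 2, and contain a cycle. If \<open>p\<close> misses some \<open>s\<close>, there
  are exactly seven vertices and \<open>p\<close> sees all others except \<open>q\<close>; the two
  lemmas above apply according to whether \<open>q\<close> misses a vertex besides \<open>p\<close>
  and \<open>s\<close>.\<close>

lemma double_cone_minor_3:
  assumes N: "finite N" "card N \<le> 7"
    and deg: "\<And>x. x \<in> N \<Longrightarrow> 4 \<le> card {y \<in> N. adj x y}"
    and pq: "p \<in> N" "q \<in> N" "p \<noteq> q" "\<not> adj p q"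
  shows "double_cone_minor p q N 3"
proof -
  have cM: "card (N - {p, q}) = card N - 2" using N pq by (simp add: card_Diff_subset)
  \<comment> \<open>Stated for arbitrary \<open>p\<close>, \<open>q\<close>, since it is applied
    with both orders of the pair.\<close>
  have missing: "double_cone_minor p q N 3"
    if pq: "p \<in> N" "q \<in> N" "p \<noteq> q" "\<not> adj p q" and s: "s \<in> N - {p, q}" "\<not> adj p s" for p q s
  proof -
    have cM: "card (N - {p, q}) = card N - 2" using N pq by (simp add: card_Diff_subset)
    have "{y \<in> N. adj p y} \<subseteq> N - {p, q} - {s}" using s pq irrefl by blast
    then have "4 \<le> card (N - {p, q} - {s})"
      using deg[OF pq(1)] N(1) by (meson card_mono finite_Diff order_trans)
    then have c: "card N = 7" "card (N - {p, q} - {s}) = 4" using cM s(1) N by auto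
    have nb: "\<exists>y\<in>F. adj x y" if "x \<in> N" "F \<subseteq> N" "card F = 4" for x F
      using ex_neighbour_in[OF N(1) deg[OF that(1)] that(2)] that(3) c(1) by simp
    have p: "adj p x" if x: "x \<in> N - {p, q} - {s}" for x
    proof -
      have "card {p, q, s, x} = 4" using x s(1) pq(3) by auto
      moreover have "{p, q, s, x} \<subseteq> N" using x s(1) pq by auto
      ultimately obtain y where "y \<in> {p, q, s, x}" "adj p y" using nb pq(1) by blast
      then show ?thesis using irrefl pq s by blast
    qed
    show ?thesis
    proof (cases "\<forall>x\<in>N - {p, q} - {s}. adj q x")
      case True
      show ?thesis
      proof (rule double_cone_minor_if_one_missing[OF N(1) c(1) deg pq])
        show "N - {p, q} = insert s (N - {p, q} - {s})" using s(1) by blast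
      qed (use True p s c in auto)
    next
      case False
      then obtain t where t: "t \<in> N - {p, q} - {s}" "\<not> adj q t" by blast
      have q: "adj q x" if x: "x \<in> N - {p, q} - {t}" for x
      proof -
        have "card {p, q, t, x} = 4" using x t(1) pq(3) by auto
        moreover have "{p, q, t, x} \<subseteq> N" using x t(1) pq by auto
        ultimately obtain y where "y \<in> {p, q, t, x}" "adj q y" using nb pq(2) by blast
        then show ?thesis using irrefl pq t sym by blast
      qed
      have "card (N - {p, q} - {s} - {t}) = 3" using c(2) t(1) N(1) by simp
      then obtain a b c where abc: "N - {p, q} - {s} - {t} = {a, b, c}" "a \<noteq> b" "a \<noteq> c" "b \<noteq> c"
        by (auto simp: card_3_iff)
      show ?thesis
      proof (rule double_cone_minor_if_two_missing[OF N(1) c(1) deg pq])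
        show M: "N - {p, q} = {s, t, a, b, c}" using s(1) t(1) abc(1) by blast
        have "a \<in> N - {p, q} - {s} - {t}" "b \<in> N - {p, q} - {s} - {t}" "c \<in> N - {p, q} - {s} - {t}"
          unfolding abc(1) by simp_all
        then show D: "distinct [s, t, a, b, c]" using abc(2-) t(1) by auto
        show "adj p x" if "x \<in> {t, a, b, c}" for x
          using that D by (intro p) (auto simp: M)
        show "adj q x" if "x \<in> {s, a, b, c}" for x
          using that D by (intro q) (auto simp: M)
      qed (use s t in auto)
    qed
  qed
  show ?thesis
  proof (cases "\<forall>x\<in>N - {p, q}. adj p x \<and> adj q x")
    case False
    then consider s where "s \<in> N - {p, q}" "\<not> adj p s" | s where "s \<in> N - {q, p}" "\<not> adj q s"
      by blast
    then show ?thesis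
    proof cases
      case 1
      then show ?thesis using missing[OF pq] by blast
    next
      case 2
      then have "double_cone_minor q p N 3"
        using pq sym by (intro missing) auto
      then show ?thesis by (simp add: double_cone_minor_commute)
    qed
  next
    case True
    have "2 \<le> card {y \<in> N - {p, q}. adj x y}" if x: "x \<in> N - {p, q}" for x
    proof -
      have "{y \<in> N. adj x y} \<subseteq> {y \<in> N - {p, q}. adj x y} \<union> {p, q}" by blast
      then have "card {y \<in> N. adj x y} \<le> card ({y \<in> N - {p, q}. adj x y} \<union> {p, q})"
        using N(1) by (intro card_mono) auto
      also have "\<dots> \<le> card {y \<in> N - {p, q}. adj x y} + card {p, q}" by (rule card_Un_le)
      finally show ?thesis using deg[of x] x pq(3) by simp
    qed
    moreover have "\<exists>y\<in>N - {}. adj p y" using deg[OF pq(1)] by (intro ex_neighbour_notin) auto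
    then have "N - {p, q} \<noteq> {}" using pq(4) irrefl by blast
    ultimately have "clique_minor adj (N - {p, q}) 3"
      using N cM by (intro clique_minor_3_if_mindegree_2) auto
    then obtain Bs where Bs: "length Bs = 3" "branch_sets adj Bs" "\<Union>(set Bs) \<subseteq> N - {p, q}"
      by (auto simp: clique_minor_def)
    have "touch adj {p} B \<and> touch adj {q} B" if "B \<in> set Bs" for B
    proof -
      have "B \<noteq> {}" "B \<subseteq> N - {p, q}" using Bs that by (auto simp: branch_sets_def connected_set_def)
      then show ?thesis using True unfolding touch_def by blast
    qed
    then show ?thesis using Bs unfolding double_cone_minor_def by blast
  qed
qed


section \<open>Graphs whose edges lie in four triangles\<close>

text \<open>Ordered pairs are counted, so \<open>arcs X X\<close> is the degree sum within
  \<open>X\<close>, twice the number of its edges.\<close>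

definition arcs :: "'a set \<Rightarrow> 'a set \<Rightarrow> nat" where
  "arcs A B = (\<Sum>a\<in>A. card {b \<in> B. adj a b})"

lemma arcs_commute:
  assumes "finite A" "finite B"
  shows "arcs A B = arcs B A"
proof -
  have *: "arcs X Y = (\<Sum>a\<in>X. \<Sum>b\<in>Y. of_bool (adj a b))" if "finite Y" for X Y
    unfolding arcs_def using that by (simp add: Int_def)
  show ?thesis
    unfolding *[OF assms(1)] *[OF assms(2)] by (subst sum.swap) (simp add: adj_commute)
qed

lemma arcs_Un_left:
  "finite A \<Longrightarrow> finite B \<Longrightarrow> A \<inter> B = {} \<Longrightarrow> arcs (A \<union> B) C = arcs A C + arcs B C"
  unfolding arcs_def by (rule sum.union_disjoint)

lemma arcs_Un_right:
  assumes "finite A" "finite B" "finite C" "A \<inter> B = {}"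
  shows "arcs C (A \<union> B) = arcs C A + arcs C B"
  using assms arcs_commute[of C "A \<union> B"] arcs_commute[of C A] arcs_commute[of C B] arcs_Un_left[of A B C]
  by simp

lemma arcs_clique:
  assumes "finite K" "pairwise adj K"
  shows "arcs K K = card K * (card K - 1)"
proof -
  have "card {b \<in> K. adj a b} = card K - 1" if "a \<in> K" for a
  proof -
    have "{b \<in> K. adj a b} = K - {a}" using assms(2) that irrefl by (auto simp: pairwise_def)
    then show ?thesis using that assms(1) by simp
  qed
  then show ?thesis by (simp add: arcs_def)
qed

definition boundary :: "'a set \<Rightarrow> 'a set" where
  "boundary C = {y. y \<notin> C \<and> (\<exists>x\<in>C. adj x y)}"

text \<open>If \<open>x\<close> had only three neighbours in \<open>C\<close>, these together with the boundary
  would form a \<open>K\<^sub>6\<close>.\<close>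

lemma card_neighbours_of_boundary:
  assumes tri: "\<And>x y. adj x y \<Longrightarrow> 4 \<le> card {z. adj x z \<and> adj y z}"
    and C: "finite C" and K: "finite (boundary C)" "card (boundary C) \<le> 3" "pairwise adj (boundary C)"
    and no: "\<not> clique_minor adj (C \<union> boundary C) 6" and x: "x \<in> boundary C"
  shows "4 \<le> card {y \<in> C. adj x y}"
proof (rule ccontr)
  assume "\<not> ?thesis"
  then have c3: "card {y \<in> C. adj x y} \<le> 3" by simp
  let ?D = "{y \<in> C. adj x y}" and ?K = "boundary C"
  have xC: "x \<notin> C" using x by (simp add: boundary_def)
  have sub: "{z. adj x z \<and> adj y z} \<subseteq> (?D - {y}) \<union> (?K - {x})" if "y \<in> ?D" for y
  proof
    fix z assume z: "z \<in> {z. adj x z \<and> adj y z}"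
    then have "z \<in> C \<or> z \<in> ?K" using that by (auto simp: boundary_def)
    then show "z \<in> (?D - {y}) \<union> (?K - {x})" using z irrefl by blast
  qed
  have fin: "finite ((?D - {y}) \<union> (?K - {x}))" for y using C K(1) by simp
  have card: "card ((?D - {y}) \<union> (?K - {x})) \<le> (card ?D - 1) + (card ?K - 1)" if "y \<in> ?D" for y
    using card_Un_le[of "?D - {y}" "?K - {x}"] that x C K(1) by simp
  have le4: "4 \<le> card {z. adj x z \<and> adj y z}" if "y \<in> ?D" for y using tri that by simp
  obtain y0 where y0: "y0 \<in> ?D" using x sym by (auto simp: boundary_def)
  \<comment> \<open>Both sizes are at most 3, so both are exactly 3 and the inclusions in
    \<open>sub\<close> are equalities.\<close>
  have "4 \<le> (card ?D - 1) + (card ?K - 1)"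
    using card_mono[OF fin sub[OF y0]] card[OF y0] le4[OF y0] by linarith
  then have c: "card ?D = 3" "card ?K = 3" using c3 K(2) by linarith+
  have adjD: "adj y z" if y: "y \<in> ?D" and z: "z \<in> (?D - {y}) \<union> (?K - {x})" for y z
  proof -
    have "card ((?D - {y}) \<union> (?K - {x})) \<le> card {z. adj x z \<and> adj y z}"
      using card[OF y] le4[OF y] c by linarith
    then have "{z. adj x z \<and> adj y z} = (?D - {y}) \<union> (?K - {x})"
      using card_seteq[OF fin sub[OF y]] by blast
    then show ?thesis using z by blast
  qed
  have "pairwise adj (?D \<union> ?K)"
    unfolding pairwise_def
  proof (intro ballI impI)
    fix a b assume ab: "a \<in> ?D \<union> ?K" "b \<in> ?D \<union> ?K" "a \<noteq> b"
    consider "a \<in> ?D" "b = x" | "a \<in> ?D" "b \<noteq> x" | "a \<notin> ?D" "b \<in> ?D" "a = x"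
      | "a \<notin> ?D" "b \<in> ?D" "a \<noteq> x" | "a \<in> ?K" "b \<in> ?K"
      using ab by blast
    then show "adj a b"
    proof cases
      case 1 then show ?thesis using sym by blast
    next
      case 2 then show ?thesis using adjD[of a b] ab by blast
    next
      case 3 then show ?thesis by blast
    next
      case 4 then show ?thesis using adjD[of b a] ab sym by blast
    next
      case 5 then show ?thesis using K(3) ab(3) by (auto simp: pairwise_def)
    qed
  qed
  moreover have "?D \<inter> ?K = {}" by (auto simp: boundary_def)
  then have "card (?D \<union> ?K) = 6" using c C K(1) by (subst card_Un_disjoint) auto
  ultimately have "clique_minor adj (C \<union> ?K) 6" by (intro clique_minor_clique[of "?D \<union> ?K"]) auto
  then show False using no by blast
qed

text \<open>Let \<open>k\<close> be the size of the boundary. If all degrees in \<open>C\<close>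
  were at least 8, the edge bound for \<open>C\<close> with its boundary would give
  \<open>arcs ?K C + k * (k - 1) \<le> 8 * k - 8\<close>. Since \<open>arcs ?K C\<close> is at least
  \<open>4 * k\<close>, this fails for \<open>k\<close> = 1, 2, 3. Here the set is proper, so the
  bound comes without the additional 2; for \<open>k = 0\<close> the additional 2 does no
  harm.\<close>

lemma ex_low_degree:
  assumes V: "finite V" "\<And>x y. adj x y \<Longrightarrow> x \<in> V"
    and tri: "\<And>x y. adj x y \<Longrightarrow> 4 \<le> card {z. adj x z \<and> adj y z}"
    and arcs: "\<And>X. X \<subset> V \<Longrightarrow> X \<noteq> {} \<Longrightarrow> arcs X X \<le> 8 * (card X - 1)"
      "arcs V V \<le> 8 * (card V - 1) + 2"
    and no: "\<not> clique_minor adj V 6"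
    and C: "C \<subseteq> V" "C \<noteq> {}" "card (boundary C) \<le> 3" "pairwise adj (boundary C)"
      "boundary C = {} \<or> C \<union> boundary C \<noteq> V"
  shows "\<exists>v\<in>C. card {y. adj v y} \<le> 7"
proof (rule ccontr)
  assume "\<not> ?thesis"
  then have high: "8 \<le> card {y. adj v y}" if "v \<in> C" for v using that by force
  let ?K = "boundary C"
  have K: "?K \<subseteq> V" using V(2) sym by (auto simp: boundary_def)
  have fin: "finite C" "finite ?K" using V(1) C(1) K finite_subset by blast+
  have disj: "C \<inter> ?K = {}" by (auto simp: boundary_def)
  have "8 * card C = (\<Sum>v\<in>C. 8)" by simp
  also have "\<dots> \<le> arcs C (C \<union> ?K)"
    unfolding arcs_def
  proof (rule sum_mono)
    fix v assume v: "v \<in> C"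
    then have "{y. adj v y} = {y \<in> C \<union> ?K. adj v y}" by (auto simp: boundary_def)
    then show "8 \<le> card {y \<in> C \<union> ?K. adj v y}" using high[OF v] by simp
  qed
  also have "\<dots> = arcs C C + arcs C ?K" using fin disj by (simp add: arcs_Un_right)
  finally have 1: "8 * card C \<le> arcs C C + arcs C ?K" .
  have cC: "card C > 0" using fin C(2) by (simp add: card_gt_0_iff)
  show False
  proof (cases "?K = {}")
    case True
    have "arcs C C \<le> 8 * (card C - 1) + 2"
    proof (cases "C = V")
      case False
      then have "C \<subset> V" using C(1) by blast
      from arcs(1)[OF this C(2)] show ?thesis by simp
    qed (use arcs(2) in simp)
    moreover have "arcs C ?K = 0" unfolding True by (simp add: arcs_def)
    ultimately show False using 1 cC by linarith
  next
    case False
    have "arcs (C \<union> ?K) (C \<union> ?K) \<le> 8 * (card (C \<union> ?K) - 1)"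
      using C K False by (intro arcs(1)) auto
    also have "card (C \<union> ?K) = card C + card ?K" using fin disj by (simp add: card_Un_disjoint)
    finally have 2: "arcs (C \<union> ?K) (C \<union> ?K) \<le> 8 * (card C + card ?K - 1)" .
    have "arcs (C \<union> ?K) (C \<union> ?K) = arcs C C + arcs C ?K + (arcs ?K C + arcs ?K ?K)"
      using fin disj by (simp add: arcs_Un_left arcs_Un_right)
    moreover have "arcs C ?K = arcs ?K C" using fin by (rule arcs_commute)
    moreover have "arcs ?K ?K = card ?K * (card ?K - 1)" using fin(2) C(4) by (rule arcs_clique)
    moreover have "4 * card ?K \<le> arcs ?K C"
    proof -
      have "\<not> clique_minor adj (C \<union> ?K) 6" using no clique_minor_mono[of adj "C \<union> ?K" 6 V adj] C(1) K by blast
      then have "(\<Sum>x\<in>?K. 4) \<le> arcs ?K C"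
        unfolding arcs_def
        by (intro sum_mono card_neighbours_of_boundary[OF tri fin(1,2) C(3,4)])
      then show ?thesis by simp
    qed
    moreover have "card ?K = 1 \<or> card ?K = 2 \<or> card ?K = 3"
    proof -
      have "card ?K > 0" using fin(2) False by (simp add: card_gt_0_iff)
      then show ?thesis using C(3) by linarith
    qed
    ultimately show False using 1 2 cC by (elim disjE) (simp; linarith)+
  qed
qed


section \<open>Components outside the closed star of a vertex\<close>

lemma card_le_3_if_clique_in_link:
  assumes N: "finite N" "card N \<le> 7"
    and deg: "\<And>x. x \<in> N \<Longrightarrow> 4 \<le> card {y \<in> N. adj x y}"
    and no: "\<not> clique_minor adj N 5" and Q: "Q \<subseteq> N" "pairwise adj Q"
  shows "card Q \<le> 3"
proof (rule ccontr)
  assume "\<not> ?thesis"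
  then have "4 \<le> card Q" by simp
  then obtain T where T: "T \<subseteq> Q" "card T = 4" by (rule obtain_subset_with_card_n)
  have "T \<subseteq> N" using T(1) Q(1) by (rule subset_trans)
  moreover have "pairwise adj T" using Q(2) T(1) by (rule pairwise_subset)
  ultimately have "clique_minor adj N 5"
    using T(2) by (intro clique_minor_5_if_K4[OF N deg]) auto
  then show False using no by blast
qed

text \<open>Merging \<open>D\<close> into \<open>p\<close> creates the missing adjacency of
  \<open>p\<close> and \<open>q\<close>. With the three sets of a double cone and the apex
  \<open>v\<close> this makes six branch sets.\<close>

lemma clique_minor_6_if_nonadjacent_in_boundary:
  assumes N: "finite N" "card N \<le> 7"
    and deg: "\<And>x. x \<in> N \<Longrightarrow> 4 \<le> card {y \<in> N. adj x y}"
    and v: "\<And>x. x \<in> N \<Longrightarrow> adj v x"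
    and D: "connected_set adj D" "D \<inter> insert v N = {}"
    and pq: "p \<in> N \<inter> boundary D" "q \<in> N \<inter> boundary D" "p \<noteq> q" "\<not> adj p q"
  shows "clique_minor adj (insert v (N \<union> D)) 6"
proof -
  obtain Bs where Bs: "length Bs = 3" "branch_sets adj Bs" "\<Union>(set Bs) \<subseteq> N - {p, q}"
      "\<And>B. B \<in> set Bs \<Longrightarrow> touch adj {p} B \<and> touch adj {q} B"
    using double_cone_minor_3[OF N deg, of p q] pq unfolding double_cone_minor_def by blast
  obtain x where x: "x \<in> D" "adj x p" using pq(1) by (auto simp: boundary_def)
  obtain y where y: "y \<in> D" "adj y q" using pq(2) by (auto simp: boundary_def)
  have vN: "v \<notin> N" using v irrefl by blast
  have conn: "connected_set adj (insert p D)"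
    using connected_set_insert[OF D(1) x(1)] x(2) sym by blast
  have "branch_sets adj ({q} # insert p D # Bs)"
  proof -
    have "touch adj {q} (insert p D)" using y sym unfolding touch_def by blast
    moreover have "{q} \<inter> insert p D = {}" using pq D(2) by auto
    moreover have "{q} \<inter> B = {} \<and> touch adj {q} B" if "B \<in> set Bs" for B
      using Bs(3,4) that by blast
    moreover have "insert p D \<inter> B = {} \<and> touch adj (insert p D) B" if "B \<in> set Bs" for B
    proof
      show "insert p D \<inter> B = {}" using Bs(3) that D(2) by blast
      show "touch adj (insert p D) B" using Bs(4)[OF that] unfolding touch_def by blast
    qed
    ultimately show ?thesis
      using Bs(2) conn connected_set_singleton by (auto simp: branch_sets_def)
  qed
  moreover have "touch adj {v} B" if "B \<in> set ({q} # insert p D # Bs)" for B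
  proof -
    have "B' \<noteq> {} \<and> B' \<subseteq> N" if "B' \<in> set Bs" for B'
      using that Bs(2,3) by (auto simp: branch_sets_def connected_set_def)
    then have "B \<inter> N \<noteq> {}" using that pq(1,2) by auto
    then show ?thesis using v unfolding touch_def by blast
  qed
  moreover have "{v} \<inter> B = {}" if "B \<in> set ({q} # insert p D # Bs)" for B
  proof -
    have "B \<subseteq> N \<union> D" using that pq Bs(3) by auto
    then show ?thesis using vN D(2) by blast
  qed
  ultimately have "branch_sets adj ({v} # {q} # insert p D # Bs)"
    using connected_set_singleton by (simp add: branch_sets_def)
  then show ?thesis
    unfolding clique_minor_def using Bs(1,3) pq
    by (intro exI[of _ "{v} # {q} # insert p D # Bs"]) auto
qed

lemma clique_minor_6:
  assumes V: "finite V" "V \<noteq> {}" "\<And>x y. adj x y \<Longrightarrow> x \<in> V" "\<And>x. x \<in> V \<Longrightarrow> \<exists>y. adj x y"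
    and tri: "\<And>x y. adj x y \<Longrightarrow> 4 \<le> card {z. adj x z \<and> adj y z}"
    and arcs: "\<And>X. X \<subset> V \<Longrightarrow> X \<noteq> {} \<Longrightarrow> arcs X X \<le> 8 * (card X - 1)"
      "arcs V V \<le> 8 * (card V - 1) + 2"
  shows "clique_minor adj V 6"
proof (rule ccontr)
  assume no: "\<not> clique_minor adj V 6"
  \<comment> \<open>\<open>V\<close> itself qualifies, having empty boundary. The last alternative
    provides the proper subset on which the count in \<open>ex_low_degree\<close> depends.\<close>
  define P where "P = (\<lambda>C. C \<subseteq> V \<and> C \<noteq> {} \<and> card (boundary C) \<le> 3 \<and> pairwise adj (boundary C) \<and>
    (boundary C = {} \<or> C \<union> boundary C \<noteq> V))"
  have bV: "boundary X \<subseteq> V" for X using V(3) sym by (auto simp: boundary_def)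
  have "boundary V = {}" using V(3) sym by (auto simp: boundary_def)
  then have "P V" using V(2) by (simp add: P_def)
  then obtain C where C: "P C" and min: "\<And>D. P D \<Longrightarrow> card C \<le> card D"
    using ex_has_least_nat[of P V card] by blast
  let ?K = "boundary C"
  have C': "C \<subseteq> V" "C \<noteq> {}" "card ?K \<le> 3" "pairwise adj ?K" "?K = {} \<or> C \<union> ?K \<noteq> V"
    using C unfolding P_def by blast+
  have finC: "finite C" using C'(1) V(1) finite_subset by blast
  have "\<exists>v\<in>C. card {y. adj v y} \<le> 7"
  proof (rule ex_low_degree[OF V(1) _ _ _ arcs(2) no C'])
    show "x \<in> V" if "adj x y" for x y using that by (rule V(3))
    show "4 \<le> card {z. adj x z \<and> adj y z}" if "adj x y" for x y using that by (rule tri)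
    show "arcs X X \<le> 8 * (card X - 1)" if "X \<subset> V" "X \<noteq> {}" for X using that by (rule arcs(1))
  qed
  then obtain v where v: "v \<in> C" "card {y. adj v y} \<le> 7" by blast
  define N where "N = {y. adj v y}"
  have NV: "N \<subseteq> V" "v \<notin> N" using V(3) sym irrefl by (auto simp: N_def)
  have N: "finite N" "card N \<le> 7" using NV V(1) finite_subset v(2) unfolding N_def by blast+
  have deg: "4 \<le> card {y \<in> N. adj x y}" if "x \<in> N" for x
    using tri[of v x] that by (simp add: N_def)
  have no5: "\<not> clique_minor adj N 5"
  proof
    assume "clique_minor adj N 5"
    then have "clique_minor adj V (Suc 5)"
    proof (rule clique_minor_cone)
      show "adj v x" if "x \<in> N" for x using that by (simp add: N_def)
      show "v \<in> V" using C'(1) v(1) by blast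
    qed (rule NV(1))
    then show False using no by simp
  qed
  have NCK: "N \<subseteq> C \<union> ?K" using v(1) by (auto simp: N_def boundary_def)
  define W where "W = V - insert v N"
  have finW: "finite W" using V(1) by (simp add: W_def)
  \<comment> \<open>\<open>D\<close> is a component outside the closed star of \<open>v\<close>. It
    cannot lie inside \<open>C\<close>: its boundary is a clique of at most three vertices, so it
    would satisfy \<open>P\<close>, and it is smaller than \<open>C\<close> because it misses
    \<open>v\<close>.\<close>
  have comp: "pairwise adj (boundary D)" "card (boundary D) \<le> 3" "boundary D \<subseteq> N" "\<not> D \<subseteq> C"
    if D: "connected_set adj D" "D \<subseteq> W" "\<And>x y. x \<in> D \<Longrightarrow> y \<in> W \<Longrightarrow> adj x y \<Longrightarrow> y \<in> D" for D
  proof -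
    show bN: "boundary D \<subseteq> N"
    proof
      fix y assume "y \<in> boundary D"
      then obtain x where x: "x \<in> D" "adj x y" "y \<notin> D" by (auto simp: boundary_def)
      then have "y \<notin> W" "y \<in> V" using D(3) V(3) sym by blast+
      moreover have "y \<noteq> v" using x D(2) sym unfolding W_def N_def by blast
      ultimately show "y \<in> N" by (auto simp: W_def)
    qed
    show cl: "pairwise adj (boundary D)"
      unfolding pairwise_def
    proof (intro ballI impI, rule ccontr)
      fix p q assume pq: "p \<in> boundary D" "q \<in> boundary D" "p \<noteq> q" "\<not> adj p q"
      have "D \<inter> insert v N = {}" using D(2) by (auto simp: W_def)
      then have "clique_minor adj (insert v (N \<union> D)) 6"
        using pq bN N_def
        by (intro clique_minor_6_if_nonadjacent_in_boundary[OF N deg _ D(1), of v p q]) auto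
      moreover have "insert v (N \<union> D) \<subseteq> V" using v(1) C'(1) NV(1) D(2) by (auto simp: W_def)
      ultimately show False using no clique_minor_mono by blast
    qed
    show c3: "card (boundary D) \<le> 3"
      by (rule card_le_3_if_clique_in_link[OF N deg no5 bN cl])
    show "\<not> D \<subseteq> C"
    proof
      assume DC: "D \<subseteq> C"
      have vD: "v \<notin> D" "v \<notin> D \<union> boundary D" using D(2) bN NV(2) by (auto simp: W_def)
      then have "D \<union> boundary D \<noteq> V" using v(1) C'(1) by blast
      moreover have "D \<noteq> {}" using D(1) by (simp add: connected_set_def)
      ultimately have "P D" using DC C'(1) cl c3 by (simp add: P_def)
      moreover have "card D < card C" using DC vD v(1) finC by (intro psubset_card_mono) auto
      ultimately show False using min by fastforce
    qed
  qed
  \<comment> \<open>A connected set can leave \<open>C\<close> only through the boundary of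
    \<open>C\<close>.\<close>
  have cross: "D \<inter> ?K \<noteq> {}" if D: "connected_set adj D" "\<not> D \<subseteq> C" "D \<inter> C \<noteq> {}" for D
  proof (rule ccontr)
    assume "\<not> ?thesis"
    then have "D \<subseteq> C"
      using connected_set_subset_closed[OF D(1,3)] by (auto simp: boundary_def)
    then show False using D(2) by blast
  qed
  \<comment> \<open>\<open>Q\<close> is to contain every vertex of the link that has a neighbour
    outside the closed star.\<close>
  have "\<exists>Q\<subseteq>N. card Q \<le> 3 \<and> (\<forall>w\<in>W. \<forall>z\<in>N. adj w z \<longrightarrow> z \<in> Q)"
  proof (cases "?K \<inter> W = {}")
    case True
    \<comment> \<open>With \<open>?K\<close> disjoint from \<open>W\<close>, no component can cross
      it, so all components avoid \<open>C\<close> and attach to the link within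
      \<open>?K\<close>.\<close>
    have "z \<in> ?K \<inter> N" if wz: "w \<in> W" "z \<in> N" "adj w z" for w z
    proof -
      obtain D where D: "w \<in> D" "D \<subseteq> W" "connected_set adj D"
          "\<And>x y. x \<in> D \<Longrightarrow> y \<in> W \<Longrightarrow> adj x y \<Longrightarrow> y \<in> D"
        by (rule ex_component[OF finW wz(1)]) (rule that)
      have "\<not> D \<subseteq> C" by (rule comp(4)[OF D(3,2)]) (erule (2) D(4))
      then have "D \<inter> C = {}" using cross[OF D(3)] True D(2) by blast
      then have "w \<notin> C" using D(1) by blast
      moreover have "w \<notin> ?K" using True wz(1) by blast
      ultimately have "z \<notin> C" using wz(3) sym by (auto simp: boundary_def)
      then show ?thesis using NCK wz(2) by blast
    qed
    moreover have "card (?K \<inter> N) \<le> 3"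
    proof -
      have "finite ?K" using bV V(1) by (rule finite_subset)
      then have "card (?K \<inter> N) \<le> card ?K" by (intro card_mono) auto
      then show ?thesis using C'(3) by linarith
    qed
    ultimately show ?thesis by (intro exI[of _ "?K \<inter> N"]) blast
  next
    case False
    then obtain k where k: "k \<in> ?K" "k \<in> W" by blast
    obtain D0 where D0: "k \<in> D0" "D0 \<subseteq> W" "connected_set adj D0"
        "\<And>x y. x \<in> D0 \<Longrightarrow> y \<in> W \<Longrightarrow> adj x y \<Longrightarrow> y \<in> D0"
      by (rule ex_component[OF finW k(2)]) (rule that)
    \<comment> \<open>\<open>?K\<close> is a clique, so every component meeting it is that of
      \<open>k\<close>. A component avoiding it attaches to link vertices in \<open>?K\<close>,
      which are adjacent to \<open>k\<close> and hence also in the boundary of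
      \<open>D0\<close>.\<close>
    have "z \<in> boundary D0" if wz: "w \<in> W" "z \<in> N" "adj w z" for w z
    proof -
      have zW: "z \<notin> W" using wz(2) by (simp add: W_def)
      then have zD0: "z \<notin> D0" using D0(2) by blast
      obtain D where D: "w \<in> D" "D \<subseteq> W" "connected_set adj D"
          "\<And>x y. x \<in> D \<Longrightarrow> y \<in> W \<Longrightarrow> adj x y \<Longrightarrow> y \<in> D"
        by (rule ex_component[OF finW wz(1)]) (rule that)
      have nDC: "\<not> D \<subseteq> C" by (rule comp(4)[OF D(3,2)]) (erule (2) D(4))
      show ?thesis
      proof (cases "D \<inter> ?K = {}")
        case True
        then have "D \<inter> C = {}" using cross[OF D(3) nDC] by blast
        then have "w \<notin> C" "w \<notin> ?K" using D(1) True by blast+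
        then have "z \<notin> C" using wz(3) sym by (auto simp: boundary_def)
        then have "z \<in> ?K" using NCK wz(2) by blast
        moreover have "z \<noteq> k" using zW k(2) by blast
        ultimately have "adj k z" using C'(4) k(1) by (auto simp: pairwise_def)
        then show ?thesis using D0(1) zD0 by (auto simp: boundary_def)
      next
        case False
        then obtain k' where k': "k' \<in> D" "k' \<in> ?K" by blast
        have "k' \<in> D0"
        proof (cases "k' = k")
          case False
          then have "adj k k'" using C'(4) k(1) k'(2) by (auto simp: pairwise_def)
          then show ?thesis using D0(1,4) k'(1) D(2) by blast
        qed (use D0 in simp)
        then have "D \<inter> D0 \<noteq> {}" using k'(1) by blast
        then have "D \<subseteq> D0"
          using connected_set_subset_closed[OF D(3)] D0(4) D(2) by blast
        then show ?thesis using D(1) wz(3) zD0 by (auto simp: boundary_def)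
      qed
    qed
    moreover have "boundary D0 \<subseteq> N" "card (boundary D0) \<le> 3"
      by (rule comp(3)[OF D0(3,2)] comp(2)[OF D0(3,2)], erule (2) D0(4))+
    ultimately show ?thesis by (intro exI[of _ "boundary D0"]) blast
  qed
  then obtain Q where Q: "Q \<subseteq> N" "card Q \<le> 3" "\<And>w z. w \<in> W \<Longrightarrow> z \<in> N \<Longrightarrow> adj w z \<Longrightarrow> z \<in> Q"
    by blast
  have "4 \<le> card N"
  proof -
    obtain y where "y \<in> N" using V(4) v(1) C'(1) by (auto simp: N_def)
    then have "4 \<le> card {x \<in> N. adj y x}" by (rule deg)
    also have "\<dots> \<le> card N" using N(1) by (intro card_mono) auto
    finally show ?thesis .
  qed
  then have "Q \<noteq> N" using Q(2) by auto
  then obtain z where z: "z \<in> N" "z \<notin> Q" using Q(1) by blast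
  have "\<exists>y\<in>N - {}. adj z y" using deg[OF z(1)] by (intro ex_neighbour_notin) auto
  then obtain y where y: "y \<in> N" "adj z y" by blast
  \<comment> \<open>All neighbours of \<open>z\<close> lie in the closed star. Of its four common
    neighbours with \<open>y\<close> only \<open>v\<close> is lost on passing to the link, which
    leaves three triangles there.\<close>
  have "{x. adj z x \<and> adj y x} \<subseteq> insert v {x \<in> N. adj z x \<and> adj y x}"
  proof
    fix x assume x: "x \<in> {x. adj z x \<and> adj y x}"
    then have "x \<in> V" "x \<notin> W" using V(3) Q(3)[of x z] z sym by blast+
    then show "x \<in> insert v {x \<in> N. adj z x \<and> adj y x}" using x by (auto simp: W_def)
  qed
  then have "card {x. adj z x \<and> adj y x} \<le> card (insert v {x \<in> N. adj z x \<and> adj y x})"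
    using N(1) by (intro card_mono) auto
  also have "\<dots> \<le> Suc (card {x \<in> N. adj z x \<and> adj y x})" using N(1) by (simp add: card_insert_if)
  finally have "3 \<le> card {x \<in> N. adj z x \<and> adj y x}" using tri[OF y(2)] by linarith
  then show False
    using clique_minor_5_if_edge_in_3_triangles[OF N deg z(1) y(1,2)] no5 by blast
qed


section \<open>Existence of a stress-free embedding\<close>

text \<open>Otherwise the degree sum is at least \<open>2 * d * card V\<close>, which exceeds the
  bound by \<open>2 * d - 2 > 0\<close>.\<close>

lemma ex_degree_less:
  assumes V: "finite V" "V \<noteq> {}" "\<And>x y. adj x y \<Longrightarrow> y \<in> V"
    and arcs: "arcs V V \<le> 2 * d * (card V - 1) + 2" and d: "2 \<le> d"
  shows "\<exists>v\<in>V. card {y. adj v y} < 2 * d"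
proof (rule ccontr)
  assume "\<not> ?thesis"
  then have high: "2 * d \<le> card {y. adj v y}" if "v \<in> V" for v using that by force
  have "card V * (2 * d) = (\<Sum>v\<in>V. 2 * d)" by simp
  also have "\<dots> \<le> arcs V V"
    unfolding arcs_def
  proof (rule sum_mono)
    fix v assume v: "v \<in> V"
    have "{y \<in> V. adj v y} = {y. adj v y}" using V(3) by blast
    then show "2 * d \<le> card {y \<in> V. adj v y}" using high[OF v] by simp
  qed
  finally have "card V * (2 * d) \<le> (card V - 1) * (2 * d) + 2" using arcs by (simp add: mult.commute)
  moreover obtain n where "card V = Suc n" using V(1,2) by (metis card_gt_0_iff gr0_implies_Suc)
  ultimately show False using d by simp
qed

text \<open>A vertex of degree below \<open>2 * (r - 2)\<close> has a link of minimum degree at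
  least \<open>r - 2\<close>. For \<open>r\<close> = 4, 5 this link has at most 3 or 5 vertices, few
  enough for the minimum-degree lemmas, and the vertex is the apex of a cone over the minor
  found.\<close>

lemma clique_minor_if_edges_in_triangles:
  assumes V: "finite V" "V \<noteq> {}" "\<And>x y. adj x y \<Longrightarrow> x \<in> V" "\<And>x. x \<in> V \<Longrightarrow> \<exists>y. adj x y"
    and r: "2 \<le> r" "r \<le> 6"
    and tri: "\<And>x y. adj x y \<Longrightarrow> r - 2 \<le> card {z. adj x z \<and> adj y z}"
    and arcs: "\<And>X. X \<subset> V \<Longrightarrow> X \<noteq> {} \<Longrightarrow> arcs X X \<le> 2 * (r - 2) * (card X - 1)"
      "arcs V V \<le> 2 * (r - 2) * (card V - 1) + 2"
  shows "clique_minor adj V r"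
proof -
  have V': "y \<in> V" if "adj x y" for x y using V(3) sym that by blast
  obtain x y where xy: "adj x y" using V(2,4) by blast
  then have xy': "x \<in> V" "y \<in> V" "x \<noteq> y" using V(3) V' irrefl by blast+
  have link: "clique_minor adj V r"
    if r4: "4 \<le> r"
      and K: "\<And>N. finite N \<Longrightarrow> card N < 2 * (r - 2) \<Longrightarrow> N \<noteq> {} \<Longrightarrow>
        (\<And>x. x \<in> N \<Longrightarrow> r - 2 \<le> card {y \<in> N. adj x y}) \<Longrightarrow> clique_minor adj N (r - 1)"
  proof -
    have "\<exists>v\<in>V. card {y. adj v y} < 2 * (r - 2)"
      by (rule ex_degree_less[OF V(1,2) _ arcs(2)]) (use V' r4 in auto)
    then obtain v where v: "v \<in> V" "card {y. adj v y} < 2 * (r - 2)" by blast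
    let ?N = "{y. adj v y}"
    have N: "?N \<subseteq> V" "?N \<noteq> {}" using V' V(4)[OF v(1)] by blast+
    have "clique_minor adj ?N (r - 1)"
    proof (rule K)
      show "finite ?N" using N(1) V(1) by (rule finite_subset)
      show "r - 2 \<le> card {y \<in> ?N. adj x y}" if "x \<in> ?N" for x using tri[of v x] that by simp
    qed (use v N in auto)
    then have "clique_minor adj V (Suc (r - 1))"
      by (rule clique_minor_cone) (use v N in auto)
    then show ?thesis using r4 by simp
  qed
  consider "r = 2" | "r = 3" | "r = 4" | "r = 5" | "r = 6" using r by linarith
  then show ?thesis
  proof cases
    case 1
    then show ?thesis
      using xy xy' by (intro clique_minor_clique[of "{x, y}"]) (auto simp: pairwise_insert intro: sym)
  next
    case 2
    then have "card {z. adj x z \<and> adj y z} > 0" using tri[OF xy] by simp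
    then have "{z. adj x z \<and> adj y z} \<noteq> {}" unfolding card_gt_0_iff by (rule conjunct1)
    then obtain z where z: "adj x z" "adj y z" by blast
    then have "z \<noteq> x" "z \<noteq> y" "z \<in> V" using irrefl V' by blast+
    then show ?thesis
      using 2 xy xy' z
      by (intro clique_minor_clique[of "{x, y, z}"]) (auto simp: pairwise_insert intro: sym)
  next
    case 3
    show ?thesis
      by (rule link) (use 3 in \<open>auto intro: clique_minor_3_if_mindegree_2\<close>)
  next
    case 4
    show ?thesis
      by (rule link) (use 4 in \<open>auto intro: clique_minor_4_if_mindegree_3\<close>)
  next
    case 5
    have "clique_minor adj V 6"
    proof (rule clique_minor_6[OF V(1,2)])
      show "4 \<le> card {z. adj x z \<and> adj y z}" if "adj x y" for x y using tri[OF that] 5 by simp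
      show "arcs X X \<le> 8 * (card X - 1)" if "X \<subset> V" "X \<noteq> {}" for X using arcs(1)[OF that] 5 by simp
    qed (use arcs(2) 5 V(3,4) in auto)
    then show ?thesis using 5 by simp
  qed
qed

end

lemma adjacency_adjacent:
  assumes "simple_graph G"
  shows "adjacency (adjacent G)"
proof
  show "adjacent G y x" if "adjacent G x y" for x y using symp_adjacent that by (rule sympD)
  show "\<not> adjacent G x x" for x
    using simple_graph_edgeD(1)[OF assms, of x x] by (auto simp: adjacent_def)
qed

lemma arcs_eq_card_edges:
  assumes G: "simple_graph G" and X: "finite X"
  shows "adjacency.arcs (adjacent G) X X = 2 * card {e \<in> edges G. e \<subseteq> X}"
proof -
  interpret adjacency "adjacent G" using G by (rule adjacency_adjacent)
  let ?E = "{e \<in> edges G. e \<subseteq> X}"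
  have "card {b \<in> X. adjacent G a b} = card {e \<in> ?E. a \<in> e}" if a: "a \<in> X" for a
  proof -
    have "{e \<in> ?E. a \<in> e} = (\<lambda>b. {a, b}) ` {b \<in> X. adjacent G a b}"
    proof (intro equalityI subsetI)
      fix e assume e: "e \<in> {e \<in> ?E. a \<in> e}"
      then have "e \<in> edges G" by blast
      with G obtain u v where "e = {u, v}" by (rule simple_graph_edgeE)
      then obtain b where "e = {a, b}" using e by blast
      then show "e \<in> (\<lambda>b. {a, b}) ` {b \<in> X. adjacent G a b}"
        using e by (intro image_eqI[of _ _ b]) (auto simp: adjacent_def)
    qed (use a in \<open>auto simp: adjacent_def\<close>)
    then show ?thesis by (simp add: card_image inj_on_def doubleton_eq_iff)
  qed
  then have "arcs X X = (\<Sum>a\<in>X. card {e \<in> ?E. a \<in> e})" by (simp add: arcs_def)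
  also have "\<dots> = (\<Sum>e\<in>?E. 2)"
  proof (rule sum_multicount_gen)
    show "\<forall>e\<in>?E. card {a \<in> X. a \<in> e} = 2"
    proof
      fix e assume e: "e \<in> ?E"
      then have "e \<in> edges G" by blast
      with G obtain u v where "e = {u, v}" "u \<noteq> v" by (rule simple_graph_edgeE)
      moreover have "{a \<in> X. a \<in> e} = e" using e by blast
      ultimately show "card {a \<in> X. a \<in> e} = 2" by simp
    qed
  qed (use X finite_edges[OF G] in auto)
  finally show ?thesis by simp
qed

text \<open>Contractions and proper subgraphs have fewer edges and acquire no
  \<open>r\<close>-clique minor. The former provide an embedding to be split; the latter provide the
  edge bounds that force a minor when no edge can be split.\<close>

lemma ex_stress_free:
  assumes r: "2 \<le> r" "r \<le> 6" and "simple_graph G" "\<not> clique_minor (adjacent G) (verts G) r"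
  shows "\<exists>f. stress_free (r - 2) G f"
  using assms(3,4)
proof (induction "card (edges G)" arbitrary: G rule: less_induct)
  case less
  note G = less.prems(1) and no = less.prems(2)
  interpret adjacency "adjacent G" using G by (rule adjacency_adjacent)
  \<comment> \<open>The graph with edge set \<open>F\<close> has a stress-free embedding by
    induction, so the rank bound applies to it.\<close>
  have sub: "card F \<le> (r - 2) * (card X - 1)"
    if F: "F \<subset> edges G" and X: "finite X" "X \<noteq> {}" "\<Union>F \<subseteq> X" for F X
  proof -
    have H: "simple_graph (verts G, F)" using G F by (auto simp: simple_graph_def)
    have "\<not> clique_minor (adjacent (verts G, F)) (verts G) r"
    proof
      assume "clique_minor (adjacent (verts G, F)) (verts G) r"
      then have "clique_minor (adjacent G) (verts G) r"
        by (rule clique_minor_mono[OF _ order_refl]) (use F in \<open>auto simp: adjacent_def\<close>)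
      then show False using no by blast
    qed
    moreover have "card F < card (edges G)" using F finite_edges[OF G] by (rule psubset_card_mono[rotated])
    ultimately obtain f where "stress_free (r - 2) (verts G, F) f"
      using less.hyps[of "(verts G, F)"] H by auto
    from card_edges_le_if_stress_free[OF H this X(1,2)] X(3) show ?thesis by simp
  qed
  show ?case
  proof (cases "edges G = {}")
    case True
    then have "stress_free (r - 2) G f" for f by (simp add: stress_free_def)
    then show ?thesis by blast
  next
    case nonempty: False
    show ?thesis
    proof (cases "\<exists>v u. {v, u} \<in> edges G \<and> card {x. {v, x} \<in> edges G \<and> {u, x} \<in> edges G} < r - 2")
      case True
      then obtain v u where vu: "{v, u} \<in> edges G"
          "card {x. {v, x} \<in> edges G \<and> {u, x} \<in> edges G} < r - 2" by blast
      have "\<not> clique_minor (adjacent (contract v u G)) (verts (contract v u G)) r"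
        using clique_minor_of_contract[OF G vu(1)] no by blast
      then obtain f where "stress_free (r - 2) (contract v u G) f"
        using less.hyps[OF card_edges_contract_less[OF G vu(1)] simple_graph_contract[OF G vu(1)]]
        by blast
      then show ?thesis using ex_stress_free_if_contract[OF G vu(1) _ vu(2)] by blast
    next
      case False
      \<comment> \<open>Isolated vertices are left out, so that each vertex of \<open>V\<close> has
        a neighbour.\<close>
      define V where "V = \<Union>(edges G)"
      have Vsub: "V \<subseteq> verts G" using simple_graph_edge_subset[OF G] by (auto simp: V_def)
      have finV: "finite V" using Vsub finite_verts[OF G] by (rule finite_subset)
      have edge: "\<exists>a b. e = {a, b} \<and> a \<noteq> b" if e: "e \<in> edges G" for e
        using G e by (rule simple_graph_edgeE) blast
      have "clique_minor (adjacent G) V r"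
      proof (rule clique_minor_if_edges_in_triangles[OF finV _ _ _ r])
        show "V \<noteq> {}" using nonempty edge unfolding V_def by fastforce
        show "x \<in> V" if "adjacent G x y" for x y
          using that by (auto simp: adjacent_def V_def)
        show "\<exists>y. adjacent G x y" if x: "x \<in> V" for x
        proof -
          obtain e where e: "e \<in> edges G" "x \<in> e" using x unfolding V_def by blast
          then obtain y where "e = {x, y}" using edge[OF e(1)] by blast
          then show ?thesis using e by (auto simp: adjacent_def)
        qed
        show "r - 2 \<le> card {z. adjacent G x z \<and> adjacent G y z}" if "adjacent G x y" for x y
          using that False by (auto simp: adjacent_def not_less)
        show "arcs X X \<le> 2 * (r - 2) * (card X - 1)" if X: "X \<subset> V" "X \<noteq> {}" for X
        proof -
          have finX: "finite X" using X(1) finV finite_subset by blast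
          obtain e x where "e \<in> edges G" "x \<in> e" "x \<notin> X" using X(1) unfolding V_def by blast
          then have "{e \<in> edges G. e \<subseteq> X} \<subset> edges G" by blast
          from sub[OF this finX X(2)] have "card {e \<in> edges G. e \<subseteq> X} \<le> (r - 2) * (card X - 1)"
            by blast
          then show ?thesis unfolding arcs_eq_card_edges[OF G finX] by (simp add: mult.assoc)
        qed
        show "arcs V V \<le> 2 * (r - 2) * (card V - 1) + 2"
        proof -
          \<comment> \<open>The induction hypothesis needs a proper subset of the edges; the edge
            removed for it accounts for the summand 2.\<close>
          obtain e where e: "e \<in> edges G" using nonempty by blast
          then have "V \<noteq> {}" using edge[OF e] e unfolding V_def by blast
          moreover have "edges G - {e} \<subset> edges G" using e by blast
          ultimately have "card (edges G - {e}) \<le> (r - 2) * (card V - 1)"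
            using finV by (intro sub) (auto simp: V_def)
          then have "card (edges G) \<le> (r - 2) * (card V - 1) + 1"
            using e finite_edges[OF G] by simp
          moreover have "{e \<in> edges G. e \<subseteq> V} = edges G" by (auto simp: V_def)
          ultimately show ?thesis unfolding arcs_eq_card_edges[OF G finV] by (simp add: mult.assoc)
        qed
      qed
      then have "clique_minor (adjacent G) (verts G) r"
        using Vsub by (rule clique_minor_mono)
      then show ?thesis using no by blast
    qed
  qed
qed

theorem theorem1p3:
  fixes G :: "'a sgraph" and r :: nat
  assumes "2 \<le> r" and "r \<le> 6"
    and "simple_graph G"
    and "\<not> is_minor (complete_graph r) G"
  shows "generically_stress_free (r - 2) G"
proof -
  have "\<not> clique_minor (adjacent G) (verts G) r"
    using assms(3,4) is_minor_if_clique_minor by blast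
  then obtain f where "stress_free (r - 2) G f"
    using ex_stress_free assms(1-3) by blast
  then show ?thesis using assms(3) generically_stress_freeI by blast
qed

end
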